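(* For ONE-ONE-LQ instances, the problems of computing a maximum-size feasible envy-free matching (MAXEFM, for instances admitting at least one feasible envy-free matching) and computing a maximum-size feasible relaxed stable matching (MAXRSM) are both fixed-parameter tractable with respect to the combined parameter $(q,\ell_{LQ})$, and also with respect to the parameter $|\overline{\mathcal{A}}|$.
   Context: A ONE-ONE-LQ instance consists of a bipartite graph $G=(\mathcal{A}\cup\mathcal{B},E)$ of agents and resources; every vertex has a strict preference order over its neighbours ($v\succ_u w$: $u$ prefers $v$ to $w$). Every resource has upper-quota $1$ and lower-quota $q^-(b)\in\{0,1\}$; $b$ is an LQ resource if $q^-(b)=1$. A matching $M\subseteq E$ has every vertex in at most one edge; $M(v)$ is the partner of $v$ or $\bot$ (least preferred). $M$ is feasible if every LQ resource is matched. $(a,b)\in E\setminus M$ is a blocking pair if $b\succ_a M(a)$ and $a\succ_b M(b)$. $a$ envies a matched agent $a'$ with $M(a')=b$ if $(a,b)\in E$, $b\succ_a M(a)$, $a\succ_b a'$; $M$ is envy-free if no such pair exists. $M$ is relaxed stable if every agent in a blocking pair is matched and $M(a)$ is an LQ resource. Parameters: $q$ = number of LQ resources; $\ell_{LQ}$ = maximum length of the preference list of an LQ resource; $\overline{\mathcal{A}}$ = set of agents acceptable to at least one LQ resource. *)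

theory Defs
  imports "HOL-Computational_Algebra.Polynomial"
begin

section \<open>Instances\<close>

text \<open>
  The agents are \<open>0, \<dots>, n_agents - 1\<close> and the resources \<open>0, \<dots>, n_resources - 1\<close>, numbered
  independently. Preference lists run from most to least preferred; the graph is given by the
  lists, whose members are exactly the neighbours.
\<close>

record lq_instance =
  n_agents :: nat
  n_resources :: nat
  lower_quota :: "nat list"
  agent_pref :: "nat list list"
  resource_pref :: "nat list list"

definition wf_instance :: "lq_instance \<Rightarrow> bool" where
  "wf_instance I \<longleftrightarrow>
     length (lower_quota I) = n_resources I \<and> set (lower_quota I) \<subseteq> {0, 1} \<and>
     length (agent_pref I) = n_agents I \<and> length (resource_pref I) = n_resources I \<and>
     (\<forall>l \<in> set (agent_pref I). distinct l \<and> set l \<subseteq> {..<n_resources I}) \<and>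
     (\<forall>l \<in> set (resource_pref I). distinct l \<and> set l \<subseteq> {..<n_agents I}) \<and>
     (\<forall>a < n_agents I. \<forall>b < n_resources I.
        b \<in> set (agent_pref I ! a) \<longleftrightarrow> a \<in> set (resource_pref I ! b))"

definition edges :: "lq_instance \<Rightarrow> (nat \<times> nat) set" where
  "edges I = {(a, b). a < n_agents I \<and> b < n_resources I \<and> b \<in> set (agent_pref I ! a)}"

definition lq_resources :: "lq_instance \<Rightarrow> nat set" where
  "lq_resources I = {b. b < n_resources I \<and> lower_quota I ! b = 1}"

text \<open>Being unmatched is represented by \<^term>\<open>None\<close>, which every listed vertex beats.\<close>

definition prefers :: "nat list \<Rightarrow> nat \<Rightarrow> nat option \<Rightarrow> bool" where
  "prefers l v w \<longleftrightarrow>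
     (case w of
        None \<Rightarrow> v \<in> set l
      | Some u \<Rightarrow> \<exists>i j. i < j \<and> j < length l \<and> l ! i = v \<and> l ! j = u)"


section \<open>Matchings\<close>

definition matching :: "lq_instance \<Rightarrow> (nat \<times> nat) set \<Rightarrow> bool" where
  "matching I M \<longleftrightarrow> M \<subseteq> edges I \<and>
     (\<forall>a b b'. (a, b) \<in> M \<and> (a, b') \<in> M \<longrightarrow> b = b') \<and>
     (\<forall>a a' b. (a, b) \<in> M \<and> (a', b) \<in> M \<longrightarrow> a = a')"

definition agent_partner :: "(nat \<times> nat) set \<Rightarrow> nat \<Rightarrow> nat option" where
  "agent_partner M a = (if \<exists>b. (a, b) \<in> M then Some (THE b. (a, b) \<in> M) else None)"

definition resource_partner :: "(nat \<times> nat) set \<Rightarrow> nat \<Rightarrow> nat option" where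
  "resource_partner M b = (if \<exists>a. (a, b) \<in> M then Some (THE a. (a, b) \<in> M) else None)"

definition feasible :: "lq_instance \<Rightarrow> (nat \<times> nat) set \<Rightarrow> bool" where
  "feasible I M \<longleftrightarrow> (\<forall>b \<in> lq_resources I. resource_partner M b \<noteq> None)"

definition blocking_pair :: "lq_instance \<Rightarrow> (nat \<times> nat) set \<Rightarrow> nat \<Rightarrow> nat \<Rightarrow> bool" where
  "blocking_pair I M a b \<longleftrightarrow> (a, b) \<in> edges I - M \<and>
     prefers (agent_pref I ! a) b (agent_partner M a) \<and>
     prefers (resource_pref I ! b) a (resource_partner M b)"

definition envies :: "lq_instance \<Rightarrow> (nat \<times> nat) set \<Rightarrow> nat \<Rightarrow> nat \<Rightarrow> bool" where
  "envies I M a a' \<longleftrightarrow> (\<exists>b. agent_partner M a' = Some b \<and> (a, b) \<in> edges I \<and>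
     prefers (agent_pref I ! a) b (agent_partner M a) \<and>
     prefers (resource_pref I ! b) a (Some a'))"

definition envy_free :: "lq_instance \<Rightarrow> (nat \<times> nat) set \<Rightarrow> bool" where
  "envy_free I M \<longleftrightarrow> \<not> (\<exists>a a'. envies I M a a')"

definition relaxed_stable :: "lq_instance \<Rightarrow> (nat \<times> nat) set \<Rightarrow> bool" where
  "relaxed_stable I M \<longleftrightarrow> (\<forall>a b. blocking_pair I M a b \<longrightarrow>
     (\<exists>b' \<in> lq_resources I. agent_partner M a = Some b'))"

definition feasible_efm :: "lq_instance \<Rightarrow> (nat \<times> nat) set \<Rightarrow> bool" where
  "feasible_efm I M \<longleftrightarrow> matching I M \<and> feasible I M \<and> envy_free I M"

definition feasible_rsm :: "lq_instance \<Rightarrow> (nat \<times> nat) set \<Rightarrow> bool" where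
  "feasible_rsm I M \<longleftrightarrow> matching I M \<and> feasible I M \<and> relaxed_stable I M"

definition max_size :: "((nat \<times> nat) set \<Rightarrow> bool) \<Rightarrow> (nat \<times> nat) set \<Rightarrow> bool" where
  "max_size P M \<longleftrightarrow> P M \<and> (\<forall>N. P N \<longrightarrow> card N \<le> card M)"


section \<open>Parameters\<close>

definition num_lq :: "lq_instance \<Rightarrow> nat" where
  "num_lq I = card (lq_resources I)"

text \<open>The inserted \<open>0\<close> only matters for instances without LQ resources.\<close>

definition max_lq_list :: "lq_instance \<Rightarrow> nat" where
  "max_lq_list I = Max (insert 0 ((\<lambda>b. length (resource_pref I ! b)) ` lq_resources I))"

definition lq_agents :: "lq_instance \<Rightarrow> nat set" where
  "lq_agents I = {a. \<exists>b \<in> lq_resources I. (a, b) \<in> edges I}"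


section \<open>Random access machines\<close>

text \<open>
  Structured programs for a random access machine over the natural numbers with uniform cost
  measure, whose arithmetic consists of addition and truncated subtraction. The store is a family
  of unbounded arrays, of which each program can address only finitely many; a scalar variable is
  cell \<open>0\<close> of an array. A command is charged one step whatever expressions it contains, since in
  a fixed program these have constant size. As there is no multiplication, numbers grow by
  \<open>O(1)\<close> bits per step, so that the running time is polynomially related to that of Turing
  machines.
\<close>

datatype aexp = Num nat | Cell nat aexp | Plus aexp aexp | Minus aexp aexp

datatype bexp = Less aexp aexp | Neg bexp | Conj bexp bexp

datatype com =
    Skip
  | Assign nat aexp aexp
  | Seq com com
  | Cond bexp com com
  | While bexp com

type_synonym store = "nat \<Rightarrow> nat \<Rightarrow> nat"

primrec aval :: "aexp \<Rightarrow> store \<Rightarrow> nat" where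
  "aval (Num n) s = n"
| "aval (Cell x e) s = s x (aval e s)"
| "aval (Plus d e) s = aval d s + aval e s"
| "aval (Minus d e) s = aval d s - aval e s"

primrec bval :: "bexp \<Rightarrow> store \<Rightarrow> bool" where
  "bval (Less d e) s = (aval d s < aval e s)"
| "bval (Neg b) s = (\<not> bval b s)"
| "bval (Conj b c) s = (bval b s \<and> bval c s)"

text \<open>\<open>exec c s t s'\<close>: started in \<open>s\<close>, the program \<open>c\<close> halts after exactly \<open>t\<close> steps in \<open>s'\<close>.\<close>

inductive exec :: "com \<Rightarrow> store \<Rightarrow> nat \<Rightarrow> store \<Rightarrow> bool" where
  Skip: "exec Skip s 1 s"
| Assign: "exec (Assign x d e) s 1 (s(x := (s x)(aval d s := aval e s)))"
| Seq: "exec c s t s' \<Longrightarrow> exec d s' u s'' \<Longrightarrow> exec (Seq c d) s (t + u) s''"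
| CondTrue: "bval b s \<Longrightarrow> exec c s t s' \<Longrightarrow> exec (Cond b c d) s (t + 1) s'"
| CondFalse: "\<not> bval b s \<Longrightarrow> exec d s t s' \<Longrightarrow> exec (Cond b c d) s (t + 1) s'"
| WhileFalse: "\<not> bval b s \<Longrightarrow> exec (While b c) s 1 s"
| WhileTrue: "bval b s \<Longrightarrow> exec c s t s' \<Longrightarrow> exec (While b c) s' u s'' \<Longrightarrow>
    exec (While b c) s (t + u + 1) s''"

inductive_cases exec_SkipE: "exec Skip s t s'"
inductive_cases exec_AssignE: "exec (Assign x d e) s t s'"
inductive_cases exec_SeqE: "exec (Seq c d) s t s'"
inductive_cases exec_CondE: "exec (Cond b c d) s t s'"
inductive_cases exec_WhileE: "exec (While b c) s t s'"

lemma exec_deterministic: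
  "exec c s t s' \<Longrightarrow> exec c s u s'' \<Longrightarrow> t = u \<and> s' = s''"
proof (induction arbitrary: u s'' rule: exec.induct)
  case Skip
  then show ?case by (auto elim: exec_SkipE)
next
  case Assign
  then show ?case by (auto elim: exec_AssignE)
next
  case (Seq c s t s1 d v s2)
  from Seq.prems obtain t' s1' v' where
    *: "u = t' + v'" "exec c s t' s1'" "exec d s1' v' s''" by (rule exec_SeqE)
  from Seq.IH(1)[OF *(2)] Seq.IH(2)[of v' s''] * show ?case by simp
next
  case (CondTrue b s c t s1 d)
  from CondTrue.prems show ?case
    by (rule exec_CondE) (use CondTrue.hyps(1) CondTrue.IH in \<open>simp_all\<close>)
next
  case (CondFalse b s d t s1 c)
  from CondFalse.prems show ?case
    by (rule exec_CondE) (use CondFalse.hyps(1) CondFalse.IH in \<open>simp_all\<close>)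
next
  case (WhileFalse b s c)
  from WhileFalse.prems show ?case
    by (rule exec_WhileE) (use WhileFalse.hyps in \<open>simp_all\<close>)
next
  case (WhileTrue b s c t s1 v s2)
  from WhileTrue.prems WhileTrue.hyps(1) obtain t' s1' v' where
    *: "u = t' + v' + 1" "exec c s t' s1'" "exec (While b c) s1' v' s''"
    by (auto elim: exec_WhileE)
  from WhileTrue.IH(1)[OF *(2)] WhileTrue.IH(2)[of v' s''] * show ?case by simp
qed

text \<open>A word list is passed, as input and as output, in array \<open>0\<close>, with its length in array \<open>1\<close>.\<close>

definition input_store :: "nat list \<Rightarrow> store" where
  "input_store xs = (\<lambda>x i.
     if x = 0 \<and> i < length xs then xs ! i else if x = 1 \<and> i = 0 then length xs else 0)"

definition output_words :: "store \<Rightarrow> nat list" where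
  "output_words s = map (s 0) [0..<s 1 0]"

definition computable :: "(nat list \<Rightarrow> nat) \<Rightarrow> bool" where
  "computable f \<longleftrightarrow> (\<exists>c. \<forall>xs. \<exists>t s. exec c (input_store xs) t s \<and> output_words s = [f xs])"

text \<open>
  Fixed-parameter tractability of the search problem with instances \<open>X\<close>, encoded by \<open>enc\<close>, and
  solution relation \<open>sol\<close>, with respect to the (tuple of) parameters \<open>\<kappa>\<close>. The input length is
  the number of words, so that \<open>enc\<close> should only use words of bit length polynomial in it.
\<close>

definition fpt ::
  "('i \<Rightarrow> nat list) \<Rightarrow> 'i set \<Rightarrow> ('i \<Rightarrow> nat list \<Rightarrow> bool) \<Rightarrow> ('i \<Rightarrow> nat list) \<Rightarrow> bool" where
  "fpt enc X sol \<kappa> \<longleftrightarrow>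
     (\<exists>c f (p :: nat poly). computable f \<and>
        (\<forall>x \<in> X. \<exists>t s. exec c (input_store (enc x)) t s \<and>
           t \<le> f (\<kappa> x) * poly p (length (enc x)) \<and> sol x (output_words s)))"


section \<open>The two problems\<close>

definition encode_instance :: "lq_instance \<Rightarrow> nat list" where
  "encode_instance I =
     [n_agents I, n_resources I] @ lower_quota I @
     concat (map (\<lambda>l. length l # l) (agent_pref I)) @
     concat (map (\<lambda>l. length l # l) (resource_pref I))"

text \<open>
  A matching is output as \<open>1\<close> followed by one word per agent, \<open>0\<close> for an unmatched agent and
  \<open>b + 1\<close> for one matched to \<open>b\<close>.
\<close>

definition encode_matching :: "lq_instance \<Rightarrow> (nat \<times> nat) set \<Rightarrow> nat list" where
  "encode_matching I M = 1 #
     map (\<lambda>a. case agent_partner M a of None \<Rightarrow> 0 | Some b \<Rightarrow> Suc b) [0..<n_agents I]"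

definition no_solution :: "nat list" where
  "no_solution = [0]"

definition maxefm_instances :: "lq_instance set" where
  "maxefm_instances = {I. wf_instance I \<and> (\<exists>M. feasible_efm I M)}"

definition maxefm_solution :: "lq_instance \<Rightarrow> nat list \<Rightarrow> bool" where
  "maxefm_solution I out \<longleftrightarrow> (\<exists>M. max_size (feasible_efm I) M \<and> out = encode_matching I M)"

definition maxrsm_instances :: "lq_instance set" where
  "maxrsm_instances = {I. wf_instance I}"

definition maxrsm_solution :: "lq_instance \<Rightarrow> nat list \<Rightarrow> bool" where
  "maxrsm_solution I out \<longleftrightarrow>
     (if \<exists>M. feasible_rsm I M
      then \<exists>M. max_size (feasible_rsm I) M \<and> out = encode_matching I M
      else out = no_solution)"

end

theory Submission
  imports Defs
begin

text \<open>
  Guess the set of edges of the solution at the LQ resources, and let every other agent point to the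
  top of its list. As long as some agent holding a resource \<open>b\<close> has a rival that \<open>b\<close> prefers and
  that points at \<open>b\<close> or has passed it, move its pointer down by one; the guess fails if this agent
  belongs to the guess. For relaxed stability, rivals from the guess are ignored unless they point
  at \<open>b\<close>. For the right guess no pointer ever passes the partner in the solution, since a rival
  would witness envy, or a forbidden blocking pair, in the solution. Hence the result matches
  at least as many agents as any solution with the same edges at the LQ resources. If there are
  more LQ resources than agents acceptable to them, nothing is feasible; otherwise the number of
  LQ edges, hence of guesses, is bounded in terms of either parameter.
\<close>

section \<open>Programs with bounded loops\<close>

text \<open>Two conditions resist a plain proposal process: feasibility asks for coverage that no
  agent strives for, and relaxed stability excuses an agent from every blocking pair once it is
  matched to an LQ resource. Fixing the LQ edges settles both, and what remains is monotone: in
  whatever order pointers are advanced, none overshoots a solution with these edges. Wrong guesses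
  are harmless, because a result is kept only if no failure was flagged and all LQ resources are
  covered, which makes it a solution for any guess. Since tractability refers to an actual machine,
  the algorithm has to be a program. Its loops run up to a cell that their body leaves alone; all
  these cells hold the input length, except the one with the number of guesses, so a polynomial cost
  per guess can be read off the syntax. Edges are identified with the positions of their words in
  the input, so that preferences become comparisons of numbers.\<close>

datatype for_com =
    FSkip
  | FAssign nat aexp aexp
  | FSeq for_com for_com
  | FCond bexp for_com for_com
  | For nat nat for_com

definition set_counter :: "nat \<Rightarrow> nat \<Rightarrow> store \<Rightarrow> store" where
  "set_counter v k s = s(v := (s v)(0 := k))"

text \<open>\<open>sem\<close> is total because a loop reads its bound once, before the first round.
  The compiled \<open>While\<close> rereads bound and counter in every round; the two agree under
  the conditions of \<open>exec_compile\<close>.\<close>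

primrec sem :: "for_com \<Rightarrow> store \<Rightarrow> store" where
  "sem FSkip s = s"
| "sem (FAssign x d e) s = s(x := (s x)(aval d s := aval e s))"
| "sem (FSeq c d) s = sem d (sem c s)"
| "sem (FCond b c d) s = (if bval b s then sem c s else sem d s)"
| "sem (For v l c) s =
     ((\<lambda>s. let s' = sem c s in set_counter v (Suc (s' v 0)) s') ^^ s l 0) (set_counter v 0 s)"

primrec writes :: "for_com \<Rightarrow> nat set" where
  "writes FSkip = {}"
| "writes (FAssign x d e) = {x}"
| "writes (FSeq c d) = writes c \<union> writes d"
| "writes (FCond b c d) = writes c \<union> writes d"
| "writes (For v l c) = insert v (writes c)"

primrec bounds :: "for_com \<Rightarrow> nat set" where
  "bounds FSkip = {}"
| "bounds (FAssign x d e) = {}"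
| "bounds (FSeq c d) = bounds c \<union> bounds d"
| "bounds (FCond b c d) = bounds c \<union> bounds d"
| "bounds (For v l c) = insert l (bounds c)"

primrec counters_safe :: "for_com \<Rightarrow> bool" where
  "counters_safe FSkip = True"
| "counters_safe (FAssign x d e) = True"
| "counters_safe (FSeq c d) = (counters_safe c \<and> counters_safe d)"
| "counters_safe (FCond b c d) = (counters_safe c \<and> counters_safe d)"
| "counters_safe (For v l c) = (v \<notin> writes c \<and> counters_safe c)"

abbreviation (input) Var :: "nat \<Rightarrow> aexp" where
  "Var x \<equiv> Cell x (Num 0)"

primrec compile :: "for_com \<Rightarrow> com" where
  "compile FSkip = Skip"
| "compile (FAssign x d e) = Assign x d e"
| "compile (FSeq c d) = Seq (compile c) (compile d)"
| "compile (FCond b c d) = Cond b (compile c) (compile d)"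
| "compile (For v l c) = Seq (Assign v (Num 0) (Num 0))
     (While (Less (Var v) (Var l))
        (Seq (compile c) (Assign v (Num 0) (Plus (Var v) (Num 1)))))"

text \<open>An upper bound: a conditional is charged for both branches. In a loop, 2 pays for
  initialising the counter and for the final failing test, and each round adds a test and an
  increment to the body.\<close>

primrec cost :: "(nat \<Rightarrow> nat) \<Rightarrow> for_com \<Rightarrow> nat" where
  "cost B FSkip = 1"
| "cost B (FAssign x d e) = 1"
| "cost B (FSeq c d) = cost B c + cost B d"
| "cost B (FCond b c d) = cost B c + cost B d + 1"
| "cost B (For v l c) = 2 + B l * (cost B c + 2)"

lemma set_counter_other [simp]: "x \<noteq> v \<Longrightarrow> set_counter v k s x = s x"
  by (simp add: set_counter_def)

lemma set_counter_same [simp]: "set_counter v k s v 0 = k"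
  by (simp add: set_counter_def)

lemma sem_frame: "x \<notin> writes c \<Longrightarrow> sem c s x = s x"
proof (induction c arbitrary: s)
  case (For v l c)
  have "((\<lambda>s. let s' = sem c s in set_counter v (Suc (s' v 0)) s') ^^ k) s' x = s' x" for k s'
    by (induction k) (use For in \<open>auto simp: Let_def\<close>)
  then show ?case using For by simp
qed auto

text \<open>All loops of the solver are analysed by this rule. Besides the invariant, the body may
  use the counter value and that every array outside \<open>writes\<close> still has its initial
  contents.\<close>

lemma For_invariant:
  assumes "v \<notin> writes c"
    and "Inv 0 (set_counter v 0 s)"
    and "\<And>j s'. j < s l 0 \<Longrightarrow> s' v 0 = j \<Longrightarrow> (\<And>x. x \<notin> writes (For v l c) \<Longrightarrow> s' x = s x) \<Longrightarrow>
           Inv j s' \<Longrightarrow> Inv (Suc j) (set_counter v (Suc j) (sem c s'))"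
  shows "Inv (s l 0) (sem (For v l c) s)"
proof -
  let ?g = "\<lambda>s. let s' = sem c s in set_counter v (Suc (s' v 0)) s'"
  have "j \<le> s l 0 \<Longrightarrow> Inv j ((?g ^^ j) (set_counter v 0 s)) \<and>
      (?g ^^ j) (set_counter v 0 s) v 0 = j \<and>
      (\<forall>x. x \<notin> writes (For v l c) \<longrightarrow> (?g ^^ j) (set_counter v 0 s) x = s x)" for j
  proof (induction j)
    case 0
    then show ?case using assms(2) by simp
  next
    case (Suc j)
    then show ?case
      using assms(3)[of j "(?g ^^ j) (set_counter v 0 s)"] assms(1)
      by (auto simp: Let_def sem_frame)
  qed
  from this[of "s l 0"] show ?thesis by simp
qed

lemma exec_compile:
  assumes "counters_safe c" "bounds c \<inter> writes c = {}" "\<And>l. l \<in> bounds c \<Longrightarrow> s l 0 = B l"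
  shows "\<exists>t \<le> cost B c. exec (compile c) s t (sem c s)"
  using assms
proof (induction c arbitrary: s)
  case FSkip
  show ?case by (auto intro!: exI[of _ 1] exec.Skip[simplified])
next
  case (FAssign x d e)
  show ?case unfolding compile.simps sem.simps cost.simps
    by (rule exI[of _ 1], rule conjI[OF order_refl], rule exec.Assign)
next
  case (FSeq c d)
  from FSeq.prems have disj: "bounds c \<inter> writes c = {}" "bounds d \<inter> writes d = {}" by auto
  obtain t where t: "t \<le> cost B c" "exec (compile c) s t (sem c s)"
    using FSeq.IH(1)[of s] FSeq.prems disj by auto
  have "sem c s l 0 = B l" if "l \<in> bounds d" for l
    using that FSeq.prems by (subst sem_frame) auto
  then obtain u where u: "u \<le> cost B d" "exec (compile d) (sem c s) u (sem d (sem c s))"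
    using FSeq.IH(2)[of "sem c s"] FSeq.prems disj by auto
  show ?case using exec.Seq[OF t(2) u(2)] t(1) u(1) by (intro exI[of _ "t + u"]) simp
next
  case (FCond b c d)
  from FCond.prems have disj: "bounds c \<inter> writes c = {}" "bounds d \<inter> writes d = {}" by auto
  show ?case
  proof (cases "bval b s")
    case True
    with FCond.IH(1)[of s] FCond.prems disj
    obtain t where t: "t \<le> cost B c" "exec (compile c) s t (sem c s)" by auto
    show ?thesis using exec.CondTrue[OF True t(2)] t(1) True by (intro exI[of _ "t + 1"]) simp
  next
    case False
    with FCond.IH(2)[of s] FCond.prems disj
    obtain t where t: "t \<le> cost B d" "exec (compile d) s t (sem d s)" by auto
    show ?thesis using exec.CondFalse[OF False t(2)] t(1) False by (intro exI[of _ "t + 1"]) simp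
  qed
next
  case (For v l c)
  let ?g = "\<lambda>s. let s' = sem c s in set_counter v (Suc (s' v 0)) s'"
  let ?w = "While (Less (Var v) (Var l))
    (Seq (compile c) (Assign v (Num 0) (Plus (Var v) (Num 1))))"
  have v: "v \<notin> writes c" "v \<noteq> l" "l \<notin> writes c" "bounds c \<inter> writes c = {}"
    "v \<notin> bounds c" "counters_safe c"
    using For.prems by auto
  \<comment> \<open>\<open>k\<close> is the number of rounds still to run, so the induction covers
    every intermediate store.\<close>
  have loop: "\<exists>t \<le> k * (cost B c + 2) + 1. exec ?w s t ((?g ^^ k) s)"
    if "\<And>l'. l' \<in> bounds (For v l c) \<Longrightarrow> s l' 0 = B l'" "s v 0 + k = B l" for k s
    using that
  proof (induction k arbitrary: s)
    case 0
    then show ?case by (intro exI[of _ 1]) (simp add: exec.WhileFalse[simplified])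
  next
    case (Suc k)
    obtain t where t: "t \<le> cost B c" "exec (compile c) s t (sem c s)"
      using For.IH[of s] v Suc.prems by auto
    have body: "exec (Seq (compile c) (Assign v (Num 0) (Plus (Var v) (Num 1)))) s (t + 1) (?g s)"
      using exec.Seq[OF t(2) exec.Assign[of v "Num 0" "Plus (Var v) (Num 1)"]]
      by (simp add: set_counter_def Let_def)
    have "?g s l' 0 = B l'" if "l' \<in> bounds (For v l c)" for l'
    proof -
      have "l' \<noteq> v" "l' \<notin> writes c" using v that by auto
      then show ?thesis using Suc.prems(1) that by (auto simp: Let_def sem_frame)
    qed
    moreover have "?g s v 0 + k = B l"
      using Suc.prems v by (simp add: Let_def sem_frame)
    ultimately obtain u where u: "u \<le> k * (cost B c + 2) + 1" "exec ?w (?g s) u ((?g ^^ k) (?g s))"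
      using Suc.IH by blast
    have "s v 0 < s l 0" using Suc.prems by simp
    then have "exec ?w s ((t + 1) + u + 1) ((?g ^^ k) (?g s))"
      using exec.WhileTrue[OF _ body u(2)] by simp
    moreover have "(t + 1) + u + 1 \<le> Suc k * (cost B c + 2) + 1" using t u by simp
    ultimately show ?case
      unfolding funpow_Suc_right o_apply by (intro exI[of _ "(t + 1) + u + 1"] conjI)
  qed
  have "set_counter v 0 s l' 0 = B l'" if "l' \<in> bounds (For v l c)" for l'
    using that For.prems by (cases "l' = v") auto
  then obtain t where t: "t \<le> B l * (cost B c + 2) + 1"
    "exec ?w (set_counter v 0 s) t ((?g ^^ B l) (set_counter v 0 s))"
    using loop[of "set_counter v 0 s" "B l"] by auto
  have "exec (compile (For v l c)) s (1 + t) (sem (For v l c) s)"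
    using exec.Seq[OF exec.Assign[of v "Num 0" "Num 0" s], of ?w t "sem (For v l c) s"]
      t(2) For.prems(3)[of l] by (simp add: set_counter_def)
  with t(1) show ?case by (intro exI[of _ "1 + t"]) (simp del: sem.simps compile.simps)
qed

primrec poly_cost :: "for_com \<Rightarrow> nat poly" where
  "poly_cost FSkip = 1"
| "poly_cost (FAssign x d e) = 1"
| "poly_cost (FSeq c d) = poly_cost c + poly_cost d"
| "poly_cost (FCond b c d) = poly_cost c + poly_cost d + 1"
| "poly_cost (For v l c) = [:2:] + [:0, 1:] * (poly_cost c + [:2:])"

text \<open>When all loops share one bound cell, its content is the only variable of the cost. The
  loop over the guesses does not fit this pattern and is treated in
  \<open>solver_exec\<close>.\<close>

lemma poly_cost: "bounds c \<subseteq> {l} \<Longrightarrow> cost B c = poly (poly_cost c) (B l)"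
  by (induction c) auto

section \<open>Matchings as pointers into the preference lists\<close>

lemma agent_partner_eq: "matching I M \<Longrightarrow> (a, b) \<in> M \<Longrightarrow> agent_partner M a = Some b"
  unfolding matching_def agent_partner_def by (auto intro!: the_equality)

lemma resource_partner_eq: "matching I M \<Longrightarrow> (a, b) \<in> M \<Longrightarrow> resource_partner M b = Some a"
  unfolding matching_def resource_partner_def by (auto intro!: the_equality) blast

lemma agent_partner_SomeD:
  assumes "matching I M" "agent_partner M a = Some b"
  shows "(a, b) \<in> M"
proof -
  obtain b' where "(a, b') \<in> M" using assms(2) by (auto simp: agent_partner_def split: if_splits)
  with agent_partner_eq[OF assms(1) this] assms(2) show ?thesis by simp
qed

lemma resource_partner_SomeD:
  assumes "matching I M" "resource_partner M b = Some a"
  shows "(a, b) \<in> M"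
proof -
  obtain a' where "(a', b) \<in> M" using assms(2) by (auto simp: resource_partner_def split: if_splits)
  with resource_partner_eq[OF assms(1) this] assms(2) show ?thesis by simp
qed

section \<open>Pointers and challenges on abstract edge positions\<close>

definition solution :: "bool \<Rightarrow> lq_instance \<Rightarrow> (nat \<times> nat) set \<Rightarrow> bool" where
  "solution m I = (if m then feasible_efm I else feasible_rsm I)"

lemma solution_matching: "solution m I M \<Longrightarrow> matching I M"
  by (auto simp: solution_def feasible_efm_def feasible_rsm_def split: if_splits)

lemma solution_feasible: "solution m I M \<Longrightarrow> feasible I M"
  by (auto simp: solution_def feasible_efm_def feasible_rsm_def split: if_splits)

text \<open>Abstracts from the encoding: an edge is the position \<open>p\<close> of its word in its
  agent's list, \<open>own p\<close> is the agent plus one, \<open>start\<close> gives the first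
  position of a list, and \<open>rnk p\<close> is the position of the same edge in the list of its
  resource. Preferences on both sides become comparisons of numbers, and by
  \<open>contiguous\<close> a pointer between the start of a list and an edge of it is itself at an
  edge.\<close>

locale edge_positions =
  fixes I :: lq_instance
    and pos :: "nat \<Rightarrow> bool" and own res rnk start :: "nat \<Rightarrow> nat"
  assumes finite_pos: "finite {p. pos p}"
    and pos_edge: "pos p \<Longrightarrow> 0 < own p \<and> (own p - 1, res p) \<in> edges I"
    and edge_pos: "(a, b) \<in> edges I \<Longrightarrow> \<exists>p. pos p \<and> own p = Suc a \<and> res p = b"
    and agent_order: "pos p \<Longrightarrow> pos p' \<Longrightarrow> own p = own p' \<Longrightarrow>
      prefers (agent_pref I ! (own p - 1)) (res p) (Some (res p')) \<longleftrightarrow> p < p'"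
    and resource_order: "pos p \<Longrightarrow> pos p' \<Longrightarrow> res p = res p' \<Longrightarrow>
      prefers (resource_pref I ! res p) (own p - 1) (Some (own p' - 1)) \<longleftrightarrow> rnk p < rnk p'"
    and pos_unique: "pos p \<Longrightarrow> pos p' \<Longrightarrow> own p = own p' \<Longrightarrow> res p = res p' \<Longrightarrow> p = p'"
    and rnk_inj: "pos p \<Longrightarrow> pos p' \<Longrightarrow> res p = res p' \<Longrightarrow> rnk p = rnk p' \<Longrightarrow> p = p'"
    and contiguous: "pos p \<Longrightarrow> start (own p) \<le> p' \<Longrightarrow> p' \<le> p \<Longrightarrow> pos p' \<and> own p' = own p"
    and start_le: "pos p \<Longrightarrow> start (own p) \<le> p"
    and wf: "wf_instance I"
begin

definition held :: "(nat \<Rightarrow> nat) \<Rightarrow> nat \<Rightarrow> bool" where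
  "held ptr p \<longleftrightarrow> pos p \<and> ptr (own p) = p"

text \<open>For envy-freeness (\<open>m\<close>) every agent that has reached or passed the edge
  counts. For relaxed stability an agent with nonzero \<open>fx\<close> is meant to hold an LQ
  resource and may block, so what it skipped is excused; it still counts where it points, or two
  agents could hold one resource.\<close>

definition challenged :: "bool \<Rightarrow> (nat \<Rightarrow> nat) \<Rightarrow> (nat \<Rightarrow> nat) \<Rightarrow> nat \<Rightarrow> bool" where
  "challenged m fx ptr p \<longleftrightarrow> (\<exists>p'. pos p' \<and> res p' = res p \<and> rnk p' < rnk p \<and>
     p' \<le> ptr (own p') \<and> (m \<or> fx (own p') = 0 \<or> p' = ptr (own p')))"

definition adv :: "bool \<Rightarrow> (nat \<Rightarrow> nat) \<Rightarrow> (nat \<Rightarrow> nat) \<Rightarrow> (nat \<Rightarrow> nat) \<Rightarrow> bool" where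
  "adv m fx ptr ptr' \<longleftrightarrow> (\<exists>p. held ptr p \<and> challenged m fx ptr p \<and> fx (own p) = 0 \<and>
     ptr' = ptr(own p := Suc p))"

definition matching_of :: "(nat \<Rightarrow> nat) \<Rightarrow> (nat \<times> nat) set" where
  "matching_of ptr = (\<lambda>p. (own p - 1, res p)) ` {p. held ptr p}"

definition lq_pos :: "nat \<Rightarrow> bool" where
  "lq_pos p \<longleftrightarrow> pos p \<and> res p \<in> lq_resources I"

text \<open>\<open>G\<close> may contain several edges of one agent, whose pointer is then at any
  one of them. So every set of LQ positions is an admissible guess and is judged by its result
  alone.\<close>

definition guessed :: "nat set \<Rightarrow> (nat \<Rightarrow> nat) \<Rightarrow> (nat \<Rightarrow> nat) \<Rightarrow> bool" where
  "guessed G ptr fx \<longleftrightarrow> (\<forall>p. pos p \<longrightarrow>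
     (ptr (own p) \<in> G \<and> own (ptr (own p)) = own p \<and> fx (own p) \<noteq> 0) \<or>
     ((\<forall>p' \<in> G. own p' \<noteq> own p) \<and> ptr (own p) = start (own p) \<and> fx (own p) = 0))"

definition covers :: "(nat \<Rightarrow> nat) \<Rightarrow> bool" where
  "covers ptr \<longleftrightarrow> (\<forall>b \<in> lq_resources I. \<exists>p. held ptr p \<and> res p = b)"

definition settled :: "bool \<Rightarrow> (nat \<Rightarrow> nat) \<Rightarrow> (nat \<Rightarrow> nat) \<Rightarrow> bool" where
  "settled m fx ptr \<longleftrightarrow> (\<forall>p. held ptr p \<longrightarrow> \<not> challenged m fx ptr p)"

lemma pos_Suc: "pos p \<Longrightarrow> Suc (own p - 1) = own p"
  using pos_edge[of p] by auto

lemma inj_pos: "inj_on (\<lambda>p. (own p - 1, res p)) {p. pos p}"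
proof (rule inj_onI)
  fix p p' assume "p \<in> {p. pos p}" "p' \<in> {p. pos p}" "(own p - 1, res p) = (own p' - 1, res p')"
  then show "p = p'" using pos_Suc[of p] pos_Suc[of p'] pos_unique[of p p'] by simp
qed

lemma mem_matching_of:
  assumes "pos p"
  shows "(own p - 1, res p) \<in> matching_of ptr \<longleftrightarrow> held ptr p"
  unfolding matching_of_def using inj_pos
  by (rule inj_on_image_mem_iff[of "\<lambda>p. (own p - 1, res p)" _ p "{p. held ptr p}", unfolded mem_Collect_eq])
    (use assms in \<open>auto simp: held_def\<close>)

lemma card_matching_of: "card (matching_of ptr) = card {p. held ptr p}"
  unfolding matching_of_def
  by (rule card_image) (rule inj_on_subset[OF inj_pos], auto simp: held_def)

lemma matching_of_matching:
  assumes "settled m fx ptr"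
  shows "matching I (matching_of ptr)"
proof -
  have r: "p = p'" if "held ptr p" "held ptr p'" "res p = res p'" for p p'
  proof (rule ccontr)
    assume "p \<noteq> p'"
    then have "rnk p \<noteq> rnk p'" using that rnk_inj by (auto simp: held_def)
    then consider "rnk p < rnk p'" | "rnk p' < rnk p" by linarith
    then show False
    proof cases
      case 1
      then have "challenged m fx ptr p'" using that unfolding challenged_def held_def by auto
      then show False using assms that unfolding settled_def by auto
    next
      case 2
      then have "challenged m fx ptr p" using that unfolding challenged_def held_def by auto
      then show False using assms that unfolding settled_def by auto
    qed
  qed
  have a: "p = p'" if "held ptr p" "held ptr p'" "own p - 1 = own p' - 1" for p p'
    using that pos_Suc unfolding held_def by metis
  have "matching_of ptr \<subseteq> edges I"
    using pos_edge by (auto simp: matching_of_def held_def)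
  moreover have "b = b'" if "(a, b) \<in> matching_of ptr" "(a, b') \<in> matching_of ptr" for a b b'
    using that a by (auto simp: matching_of_def)
  moreover have "a = a'" if "(a, b) \<in> matching_of ptr" "(a', b) \<in> matching_of ptr" for a a' b
    using that r by (auto simp: matching_of_def)
  ultimately show ?thesis unfolding matching_def by blast
qed

section \<open>Soundness: settled pointers that cover the LQ resources form a solution\<close>

lemma passed_or_held:
  assumes M: "matching I (matching_of ptr)" and p: "pos p" and ge: "start (own p) \<le> ptr (own p)"
    and pr: "prefers (agent_pref I ! (own p - 1)) (res p) (agent_partner (matching_of ptr) (own p - 1))"
  shows "p < ptr (own p)"
proof (cases "agent_partner (matching_of ptr) (own p - 1)")
  case None
  show ?thesis
  proof (rule ccontr)
    assume "\<not> p < ptr (own p)"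
    \<comment> \<open>A pointer not beyond \<open>p\<close> would be at an edge of the same list and
      match the agent.\<close>
    then have *: "pos (ptr (own p)) \<and> own (ptr (own p)) = own p"
      using contiguous[OF p ge] by auto
    then have "(own p - 1, res (ptr (own p))) \<in> matching_of ptr"
      using mem_matching_of[of "ptr (own p)" ptr] unfolding held_def by auto
    with None show False using agent_partner_eq[OF M] by auto
  qed
next
  case (Some b)
  then have "(own p - 1, b) \<in> matching_of ptr" by (rule agent_partner_SomeD[OF M])
  then obtain p' where p': "held ptr p'" "own p' - 1 = own p - 1" "res p' = b"
    unfolding matching_of_def by auto
  then have o: "own p' = own p" using pos_Suc p unfolding held_def by metis
  with pr Some p' p have "p < p'" using agent_order[of p p'] unfolding held_def by auto
  then show ?thesis using p' o unfolding held_def by auto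
qed

lemma adv_start_le:
  assumes "(adv m fx)\<^sup>*\<^sup>* ptr ptr'" "\<And>p. pos p \<Longrightarrow> start (own p) \<le> ptr (own p)" "pos p"
  shows "start (own p) \<le> ptr' (own p)"
  using assms
proof (induction arbitrary: p rule: rtranclp_induct)
  case (step y z)
  from step.hyps(2) obtain r where r: "held y r" "z = y(own r := Suc r)" unfolding adv_def by auto
  have "start (own p) \<le> y (own p)" using step by blast
  moreover have "own p = own r \<Longrightarrow> y (own p) = r" using r(1) by (simp add: held_def)
  ultimately show ?case unfolding r(2) by (cases "own p = own r") auto
qed auto

lemma adv_fixed:
  assumes "(adv m fx)\<^sup>*\<^sup>* ptr ptr'" "fx i \<noteq> 0"
  shows "ptr' i = ptr i"
  using assms
proof (induction rule: rtranclp_induct)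
  case (step y z)
  then show ?case unfolding adv_def by (elim exE conjE) (cases "fx i = 0"; auto)
qed simp

lemma guessed_start_le: "guessed G ptr fx \<Longrightarrow> pos p \<Longrightarrow> \<forall>p \<in> G. pos p \<Longrightarrow> start (own p) \<le> ptr (own p)"
  using start_le[of "ptr (own p)"] by (auto simp: guessed_def)

text \<open>In the relaxed stable case a rejected agent always has a better rival at the resource that
  rejected it, so that an unclaimed resource cannot be part of a blocking pair.\<close>

lemma adv_passed_claimed:
  assumes "(adv False fx)\<^sup>*\<^sup>* ptr0 ptr"
    and "\<And>p. pos p \<Longrightarrow> fx (own p) = 0 \<Longrightarrow> ptr0 (own p) = start (own p)"
    and "pos p" "p < ptr (own p)" "fx (own p) = 0"
  shows "\<exists>p'. held ptr p' \<and> res p' = res p \<and> rnk p' < rnk p"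
  using assms
proof (induction arbitrary: p rule: rtranclp_induct)
  case base
  then show ?case using start_le[of p] by auto
next
  case (step y z)
  from step.hyps(2) obtain r where r: "held y r" "challenged False fx y r" "fx (own r) = 0"
    "z = y(own r := Suc r)" unfolding adv_def by auto
  from r(2) obtain r' where r': "pos r'" "res r' = res r" "rnk r' < rnk r" "r' \<le> y (own r')"
    "fx (own r') = 0 \<or> r' = y (own r')" unfolding challenged_def by auto
  have "\<exists>p'. held y p' \<and> res p' = res r \<and> rnk p' < rnk r"
  proof (cases "r' = y (own r')")
    case True
    then show ?thesis using r' unfolding held_def by auto
  next
    case False
    then obtain p' where "held y p'" "res p' = res r'" "rnk p' < rnk r'"
      using step.IH[of r'] r' step.prems by auto
    then show ?thesis using r' by (intro exI[of _ p']) auto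
  qed
  then obtain w where w: "held y w" "res w = res r" "rnk w < rnk r" by blast
  have "own w \<noteq> own r" using w r(1) unfolding held_def by (metis less_irrefl)
  then have wz: "held z w" using w r(4) unfolding held_def by auto
  show ?case
  proof (cases "p = r")
    case True
    then show ?thesis using wz w by auto
  next
    case False
    have "y (own r) = r" using r(1) by (simp add: held_def)
    with False have "p < y (own p)"
      using step.prems(3) unfolding r(4) by (cases "own p = own r") auto
    then obtain p' where p': "held y p'" "res p' = res p" "rnk p' < rnk p"
      using step.IH[of p] step.prems by auto
    show ?thesis
    proof (cases "p' = r")
      case True
      then show ?thesis using wz w p' by (intro exI[of _ w]) auto
    next
      case False
      then have "own p' \<noteq> own r" using p' r(1) unfolding held_def by metis
      then have "held z p'" using p'(1) r(4) unfolding held_def by auto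
      then show ?thesis using p' by auto
    qed
  qed
qed

text \<open>An agent that would rather have \<open>b\<close> has passed \<open>b\<close>. If it
  envies a holder of \<open>b\<close>, it challenges that holder, against \<open>settled\<close>; if
  it blocks with \<open>b\<close>, it must be a fixed agent, hence one matched to an LQ resource.
  This works for every set \<open>G\<close> of LQ edges.\<close>

lemma settled_solution:
  assumes g: "guessed G ptr0 fx" and G: "\<forall>p \<in> G. lq_pos p"
    and adv: "(adv m fx)\<^sup>*\<^sup>* ptr0 ptr" and settled: "settled m fx ptr" and cov: "covers ptr"
  shows "solution m I (matching_of ptr)"
proof -
  let ?M = "matching_of ptr"
  have Gpos: "\<forall>p \<in> G. pos p" using G by (auto simp: lq_pos_def)
  have M: "matching I ?M" using matching_of_matching[OF settled] .
  have ge: "start (own p) \<le> ptr (own p)" if "pos p" for p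
    using adv_start_le[OF adv _ that] guessed_start_le[OF g _ Gpos] by blast
  have claimed: "\<exists>p. pos p \<and> own p = Suc a \<and> res p = b \<and> p < ptr (own p)"
    if "(a, b) \<in> edges I" "prefers (agent_pref I ! a) b (agent_partner ?M a)" for a b
  proof -
    from edge_pos[OF that(1)] obtain p where p: "pos p" "own p = Suc a" "res p = b" by blast
    with passed_or_held[OF M p(1) ge[OF p(1)]] that(2) show ?thesis by auto
  qed
  have feas: "feasible I ?M"
    unfolding feasible_def
  proof
    fix b assume "b \<in> lq_resources I"
    then obtain p where "held ptr p" "res p = b" using cov unfolding covers_def by auto
    then have "(own p - 1, b) \<in> ?M" by (auto simp: matching_of_def)
    then show "resource_partner ?M b \<noteq> None" using resource_partner_eq[OF M] by auto
  qed
  show ?thesis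
  proof (cases m)
    case True
    have "\<not> envies I ?M a a'" for a a'
    proof
      assume "envies I ?M a a'"
      then obtain b where b: "agent_partner ?M a' = Some b" "(a, b) \<in> edges I"
        "prefers (agent_pref I ! a) b (agent_partner ?M a)"
        "prefers (resource_pref I ! b) a (Some a')" unfolding envies_def by auto
      obtain p where p: "pos p" "own p = Suc a" "res p = b" "p < ptr (own p)"
        using claimed[OF b(2,3)] by auto
      have "(a', b) \<in> ?M" using agent_partner_SomeD[OF M b(1)] .
      then obtain p' where p': "held ptr p'" "own p' - 1 = a'" "res p' = b"
        by (auto simp: matching_of_def)
      have "rnk p < rnk p'" using resource_order[of p p'] p p' b(4) by (auto simp: held_def)
      then have "challenged m fx ptr p'" using p p' True by (auto simp: challenged_def)
      then show False using settled p' by (auto simp: settled_def)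
    qed
    then show ?thesis using True M feas by (simp add: solution_def feasible_efm_def envy_free_def)
  next
    case False
    have "\<exists>b' \<in> lq_resources I. agent_partner ?M a = Some b'" if bl: "blocking_pair I ?M a b" for a b
    proof -
      from bl have b: "(a, b) \<in> edges I" "prefers (agent_pref I ! a) b (agent_partner ?M a)"
        "prefers (resource_pref I ! b) a (resource_partner ?M b)"
        unfolding blocking_pair_def by auto
      obtain p where p: "pos p" "own p = Suc a" "res p = b" "p < ptr (own p)"
        using claimed[OF b(1,2)] by auto
      have no: "\<not> rnk p < rnk p'" if "held ptr p'" "res p' = b" "fx (own p) = 0" for p'
        using that settled p unfolding settled_def challenged_def by (metis less_imp_le)
      \<comment> \<open>Had a free agent passed \<open>b\<close>, then \<open>b\<close> would have a
        better holder and no reason to block.\<close>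
      have "fx (own p) \<noteq> 0"
      proof
        assume fx: "fx (own p) = 0"
        have init: "\<And>p. pos p \<Longrightarrow> fx (own p) = 0 \<Longrightarrow> ptr0 (own p) = start (own p)"
          using g unfolding guessed_def by blast
        have "(adv False fx)\<^sup>*\<^sup>* ptr0 ptr" using adv False by simp
        from adv_passed_claimed[OF this init p(1) p(4) fx]
        obtain p' where p': "held ptr p'" "res p' = res p" "rnk p' < rnk p" by auto
        then have "(own p' - 1, b) \<in> ?M" using p by (auto simp: matching_of_def)
        then have "resource_partner ?M b = Some (own p' - 1)" using resource_partner_eq[OF M] by auto
        then have "rnk p < rnk p'"
          using b(3) resource_order[of p p'] p p' by (auto simp: held_def)
        with p' show False by auto
      qed
      \<comment> \<open>A fixed agent still points at its guessed edge, which ends at an LQ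
        resource: the excuse that relaxed stability grants.\<close>
      then have "ptr0 (own p) \<in> G" "own (ptr0 (own p)) = own p" "ptr (own p) = ptr0 (own p)"
        using g[unfolded guessed_def, rule_format, OF p(1)] adv_fixed[OF adv, of "own p"] by simp_all
      then have *: "ptr (own p) \<in> G" "own (ptr (own p)) = own p" by auto
      then have "held ptr (ptr (own p))" using Gpos by (auto simp: held_def)
      then have "(a, res (ptr (own p))) \<in> ?M" using * p unfolding matching_of_def by force
      then show ?thesis using agent_partner_eq[OF M] G * by (auto simp: lq_pos_def)
    qed
    then show ?thesis using False M feas by (simp add: solution_def feasible_rsm_def relaxed_stable_def)
  qed
qed

section \<open>Completeness: the right guess never overshoots the solution\<close>

definition edge_of :: "nat \<Rightarrow> nat \<times> nat" where
  "edge_of p = (own p - 1, res p)"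

definition lq_part :: "(nat \<times> nat) set \<Rightarrow> nat set" where
  "lq_part M = {p. lq_pos p \<and> edge_of p \<in> M}"

definition below :: "(nat \<times> nat) set \<Rightarrow> (nat \<Rightarrow> nat) \<Rightarrow> bool" where
  "below M ptr \<longleftrightarrow> (\<forall>p. pos p \<and> edge_of p \<in> M \<longrightarrow> ptr (own p) \<le> p)"

text \<open>A challenge to a position of the solution would be a justified envy or a forbidden blocking
  pair of the solution, because no pointer has moved past the solution.\<close>

lemma challenged_notin_solution:
  assumes sol: "solution m I M" and below: "below M ptr"
    and fix_lq: "\<And>p. p \<in> lq_part M \<Longrightarrow> ptr (own p) = p \<and> fx (own p) \<noteq> 0"
    and p: "pos p" and ch: "challenged m fx ptr p"
  shows "edge_of p \<notin> M"
proof
  assume e: "edge_of p \<in> M"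
  note M = solution_matching[OF sol]
  from ch obtain r where r: "pos r" "res r = res p" "rnk r < rnk p" "r \<le> ptr (own r)"
    "m \<or> fx (own r) = 0 \<or> r = ptr (own r)" unfolding challenged_def by auto
  let ?a = "own r - 1" and ?b = "res p"
  have edge: "(?a, ?b) \<in> edges I" using pos_edge[OF r(1)] r(2) by simp
  have ne: "own r \<noteq> own p" using pos_unique[of r p] r p by auto
  then have nM: "(?a, ?b) \<notin> M" using e M pos_Suc[OF p] pos_Suc[OF r(1)]
    unfolding matching_def edge_of_def by metis
  have ap: "prefers (agent_pref I ! ?a) ?b (agent_partner M ?a)"
  proof (cases "agent_partner M ?a")
    case None
    then show ?thesis using edge by (simp add: prefers_def edges_def)
  next
    case (Some b)
    then have ab: "(?a, b) \<in> M" using agent_partner_SomeD[OF M] by simp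
    then have "(?a, b) \<in> edges I" using M by (auto simp: matching_def)
    then obtain r' where r': "pos r'" "own r' = Suc ?a" "res r' = b" using edge_pos by blast
    then have o: "own r' = own r" using pos_Suc[OF r(1)] by simp
    have "edge_of r' \<in> M" using r' ab by (simp add: edge_of_def)
    \<comment> \<open>The challenger has reached \<open>r\<close>, and its pointer has not passed
      its edge \<open>r'\<close> in \<open>M\<close>, so \<open>r\<close> comes no later than
      \<open>r'\<close> in its list.\<close>
    then have "r \<le> r'" using below r' r(4) o unfolding below_def by (metis order.trans)
    moreover have "r \<noteq> r'" using nM ab r'(3) r(2) by auto
    ultimately have "prefers (agent_pref I ! ?a) (res r) (Some b)"
      using agent_order[of r r'] r' r(1) o by auto
    then show ?thesis using Some r(2) by simp
  qed
  have rp: "prefers (resource_pref I ! ?b) ?a (Some (own p - 1))"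
    using resource_order[of r p] r p by simp
  have pM: "(own p - 1, ?b) \<in> M" using e by (simp add: edge_of_def)
  show False
  proof (cases m)
    case True
    have "envies I M ?a (own p - 1)"
      unfolding envies_def using agent_partner_eq[OF M pM] edge ap rp by blast
    then show False using sol True by (auto simp: solution_def feasible_efm_def envy_free_def)
  next
    case False
    have "blocking_pair I M ?a ?b"
      unfolding blocking_pair_def using resource_partner_eq[OF M pM] edge ap rp nM by simp
    then obtain b' where b': "b' \<in> lq_resources I" "agent_partner M ?a = Some b'"
      using sol False by (auto simp: solution_def feasible_rsm_def relaxed_stable_def)
    then have ab: "(?a, b') \<in> M" using agent_partner_SomeD[OF M] by simp
    then have "(?a, b') \<in> edges I" using M by (auto simp: matching_def)
    then obtain r' where r': "pos r'" "own r' = Suc ?a" "res r' = b'" using edge_pos by blast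
    then have "r' \<in> lq_part M" using ab b' by (auto simp: lq_part_def lq_pos_def edge_of_def)
    moreover have o: "own r' = own r" using r' pos_Suc[OF r(1)] by simp
    \<comment> \<open>A fixed agent challenges only where it points, which is at \<open>r'\<close>;
      the supposedly blocking edge is then an edge of \<open>M\<close>.\<close>
    ultimately have "ptr (own r) = r'" "fx (own r) \<noteq> 0" using fix_lq[of r'] by auto
    then have "r = r'" using r(5) False by auto
    then show False using nM ab r'(3) r(2) by simp
  qed
qed

text \<open>Invariant of every run, whatever the order of the advances: an advance requires a
  challenge, and by the preceding lemma no edge of \<open>M\<close> is challenged, so no pointer
  steps over one.\<close>

lemma guessed_reaches_solution:
  assumes sol: "solution m I M" and g: "guessed (lq_part M) ptr0 fx"
    and adv: "(adv m fx)\<^sup>*\<^sup>* ptr0 ptr"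
  shows "below M ptr \<and> (\<forall>p \<in> lq_part M. ptr (own p) = p \<and> fx (own p) \<noteq> 0)"
  using adv
proof (induction rule: rtranclp_induct)
  case base
  note M = solution_matching[OF sol]
  have uniq: "p = p'" if "pos p" "pos p'" "edge_of p \<in> M" "edge_of p' \<in> M" "own p = own p'" for p p'
    using that pos_unique M unfolding edge_of_def matching_def by metis
  have G: "pos p \<and> edge_of p \<in> M" if "p \<in> lq_part M" for p
    using that by (auto simp: lq_part_def lq_pos_def)
  have "ptr0 (own p) = p \<and> fx (own p) \<noteq> 0" if "p \<in> lq_part M" for p
    using g that uniq G unfolding guessed_def by metis
  moreover have "ptr0 (own p) \<le> p" if "pos p" "edge_of p \<in> M" for p
    using g that uniq G start_le unfolding guessed_def by (metis order_refl)
  ultimately show ?case by (auto simp: below_def)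
next
  case (step y z)
  from step.hyps(2) obtain r where r: "held y r" "challenged m fx y r" "fx (own r) = 0"
    "z = y(own r := Suc r)" unfolding adv_def by auto
  have nr: "edge_of r \<notin> M"
    using challenged_notin_solution[OF sol _ _ _ r(2)] step.IH r(1) by (auto simp: held_def)
  have "z (own p) \<le> p" if "pos p" "edge_of p \<in> M" for p
  proof (cases "own p = own r")
    case True
    have "y (own p) \<le> p" using step.IH that by (auto simp: below_def)
    moreover have "p \<noteq> r" using nr that by auto
    ultimately show ?thesis using r True by (auto simp: held_def)
  next
    case False
    then show ?thesis using step.IH that r by (auto simp: below_def)
  qed
  moreover have "z (own p) = p \<and> fx (own p) \<noteq> 0" if "p \<in> lq_part M" for p
    using step.IH that r by auto
  ultimately show ?case by (auto simp: below_def)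
qed

text \<open>A pointer between the start of its list and the agent's edge in \<open>M\<close> is at
  some edge, so every agent matched in \<open>M\<close> holds an edge at every reachable stage. This
  yields the size bound without comparing partners. The other two parts say that the right guess
  raises no failure and passes the final check.\<close>

lemma guessed_complete:
  assumes sol: "solution m I M" and g: "guessed (lq_part M) ptr0 fx"
    and adv: "(adv m fx)\<^sup>*\<^sup>* ptr0 ptr"
  shows "held ptr p \<Longrightarrow> challenged m fx ptr p \<Longrightarrow> fx (own p) = 0"
    and "covers ptr"
    and "card M \<le> card {p. held ptr p}"
proof -
  note M = solution_matching[OF sol]
  note R = guessed_reaches_solution[OF assms]
  have Gpos: "\<forall>p \<in> lq_part M. pos p" by (auto simp: lq_part_def lq_pos_def)
  have ge: "start (own p) \<le> ptr (own p)" if "pos p" for p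
    using adv_start_le[OF adv _ that] guessed_start_le[OF g _ Gpos] by blast
  have position: "\<exists>p. pos p \<and> edge_of p = e" if "e \<in> M" for e
  proof -
    obtain a b where ab: "e = (a, b)" by (cases e)
    with that M have "(a, b) \<in> edges I" by (auto simp: matching_def)
    then show ?thesis using edge_pos ab by (fastforce simp: edge_of_def)
  qed
  show "covers ptr"
    unfolding covers_def
  proof
    fix b assume b: "b \<in> lq_resources I"
    then have "resource_partner M b \<noteq> None" using solution_feasible[OF sol] by (auto simp: feasible_def)
    then obtain a where ab: "(a, b) \<in> M" using resource_partner_SomeD[OF M] by auto
    then obtain p where p: "pos p" "edge_of p = (a, b)" using position by blast
    then have "p \<in> lq_part M" using ab b by (auto simp: lq_part_def lq_pos_def edge_of_def)
    then have "held ptr p" using R p by (auto simp: held_def)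
    then show "\<exists>p. held ptr p \<and> res p = b" using p by (auto simp: edge_of_def)
  qed
  show "fx (own p) = 0" if h: "held ptr p" "challenged m fx ptr p" for p
  proof (rule ccontr)
    assume fx: "fx (own p) \<noteq> 0"
    have p: "pos p" "ptr (own p) = p" using h by (auto simp: held_def)
    have "ptr0 (own p) \<in> lq_part M" 
      using g[unfolded guessed_def, rule_format, OF p(1)] fx by simp
    moreover have "ptr0 (own p) = p" using adv_fixed[OF adv fx] p by simp
    ultimately have "edge_of p \<in> M" by (auto simp: lq_part_def)
    then show False using challenged_notin_solution[OF sol _ _ p(1) h(2)] R by blast
  qed
  have "\<exists>p. held ptr p \<and> own p = Suc (fst e)" if "e \<in> M" for e
  proof -
    from position[OF that] obtain p where p: "pos p" "edge_of p = e" by blast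
    then have "ptr (own p) \<le> p" using R that by (auto simp: below_def)
    then have "pos (ptr (own p)) \<and> own (ptr (own p)) = own p"
      using contiguous[OF p(1) ge[OF p(1)]] by auto
    then have "held ptr (ptr (own p))" "own (ptr (own p)) = Suc (fst e)"
      using p pos_Suc[OF p(1)] by (auto simp: held_def edge_of_def)
    then show ?thesis by blast
  qed
  then obtain h where h: "\<And>e. e \<in> M \<Longrightarrow> held ptr (h e) \<and> own (h e) = Suc (fst e)" by metis
  have "inj_on h M"
  proof (rule inj_onI)
    fix e e' assume "e \<in> M" "e' \<in> M" "h e = h e'"
    then show "e = e'" using h[of e] h[of e'] M unfolding matching_def by (cases e, cases e') auto
  qed
  moreover have "finite {p. held ptr p}"
    by (rule finite_subset[OF _ finite_pos]) (auto simp: held_def)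
  ultimately show "card M \<le> card {p. held ptr p}"
    using h by (intro card_inj_on_le[of h]) auto
qed

end

section \<open>The program\<close>

declare sem.simps(5) [simp del]

definition Eq :: "aexp \<Rightarrow> aexp \<Rightarrow> bexp" where
  "Eq d e = Conj (Neg (Less d e)) (Neg (Less e d))"

definition Le :: "aexp \<Rightarrow> aexp \<Rightarrow> bexp" where
  "Le d e = Neg (Less e d)"

definition Or :: "bexp \<Rightarrow> bexp \<Rightarrow> bexp" where
  "Or b c = Neg (Conj (Neg b) (Neg c))"

lemma bval_derived [simp]:
  "bval (Eq d e) s \<longleftrightarrow> aval d s = aval e s"
  "bval (Le d e) s \<longleftrightarrow> aval d s \<le> aval e s"
  "bval (Or b c) s \<longleftrightarrow> bval b s \<or> bval c s"
  by (auto simp: Eq_def Le_def Or_def)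

text \<open>
  Arrays: 0 input, 1 its length \<open>n\<close>, 2 number of agents, 3 first position behind the lower
  quotas, 4 entries left in the current list, 5 number of the current list, 6 start of list \<open>i\<close>,
  7 number of the list containing position \<open>p\<close>, 8 position of the edge of \<open>p\<close> in the list of its
  resource, 9 number of guesses, 10 weight of position \<open>p\<close> in a guess, 11 and 12 numbers of LQ
  resources and of agents acceptable to them, 13 marks for counting the latter, 14 rest of the
  guess, 15 failure flag, 16 size of the matching, 17 pointers, 18 fixed agents, 19 flag, 20 size
  of the best matching plus one, 21 best matching, 22 to 25 loop counters. List \<open>i + 1\<close> is that
  of agent \<open>i\<close>, followed by the lists of the resources; list number 0 means none.
\<close>

definition parse_step :: for_com where
  "parse_step =
     FCond (Less (Var 22) (Var 3)) FSkip
       (FCond (Eq (Var 4) (Num 0))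
          (FSeq (FAssign 5 (Num 0) (Plus (Var 5) (Num 1)))
          (FSeq (FAssign 4 (Num 0) (Cell 0 (Var 22)))
                (FAssign 6 (Var 5) (Plus (Var 22) (Num 1)))))
          (FSeq (FAssign 7 (Var 22) (Var 5))
                (FAssign 4 (Num 0) (Minus (Var 4) (Num 1)))))"

definition parse :: for_com where
  "parse =
     FSeq (FAssign 2 (Num 0) (Cell 0 (Num 0)))
     (FSeq (FAssign 3 (Num 0) (Plus (Num 2) (Cell 0 (Num 1))))
           (For 22 1 parse_step))"

text \<open>Looks for the other occurrence of an edge: resource \<open>b\<close> owns list number
  \<open>n_agents + 1 + b\<close>, and the word there must name the agent. Array 8 stays 0
  elsewhere, so its positivity later serves as the test for an edge position.\<close>

definition rank_step :: for_com where
  "rank_step =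
     FCond (Conj (Less (Num 0) (Cell 7 (Var 22)))
           (Conj (Le (Cell 7 (Var 22)) (Var 2))
           (Conj (Eq (Cell 7 (Var 23)) (Plus (Plus (Var 2) (Num 1)) (Cell 0 (Var 22))))
                 (Eq (Cell 7 (Var 22)) (Plus (Cell 0 (Var 23)) (Num 1))))))
       (FAssign 8 (Var 22) (Var 23)) FSkip"

definition rank :: for_com where
  "rank = For 22 1 (For 23 1 rank_step)"

definition lq_at :: "aexp \<Rightarrow> bexp" where
  "lq_at e = Conj (Less (Num 0) (Cell 8 e)) (Eq (Cell 0 (Plus (Num 2) (Cell 0 e))) (Num 1))"

text \<open>Scans from the last position to the first, doubling because there is no multiplication.
  An LQ position weighs 2 to the number of later ones, and cell 9 ends as 2 to the number of all,
  which is the number of guesses.\<close>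

definition weigh_step :: for_com where
  "weigh_step =
     FCond (lq_at (Minus (Minus (Var 1) (Num 1)) (Var 22)))
       (FSeq (FAssign 10 (Minus (Minus (Var 1) (Num 1)) (Var 22)) (Var 9))
             (FAssign 9 (Num 0) (Plus (Var 9) (Var 9)))) FSkip"

definition weigh :: for_com where
  "weigh = FSeq (FAssign 9 (Num 0) (Num 1)) (For 22 1 weigh_step)"

text \<open>The range test matters because loops run up to the input length, and beyond the
  resources \<open>2 + e\<close> hits words that are not quotas.\<close>

definition lq_resource_at :: "aexp \<Rightarrow> bexp" where
  "lq_resource_at e = Conj (Less e (Cell 0 (Num 1))) (Eq (Cell 0 (Plus (Num 2) e)) (Num 1))"

definition count_resources :: for_com where
  "count_resources =
     For 22 1 (FCond (lq_resource_at (Var 22)) (FAssign 11 (Num 0) (Plus (Var 11) (Num 1))) FSkip)"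

definition count_agents :: for_com where
  "count_agents =
     For 22 1 (FCond (Conj (lq_at (Var 22)) (Eq (Cell 13 (Cell 7 (Var 22))) (Num 0)))
       (FSeq (FAssign 13 (Cell 7 (Var 22)) (Num 1))
             (FAssign 12 (Num 0) (Plus (Var 12) (Num 1)))) FSkip)"

text \<open>With 0 guesses the search reports at once that there is no solution. This keeps
  instances with many LQ resources within a bound in the agents alone.\<close>

definition prepare :: for_com where
  "prepare =
     FSeq parse (FSeq rank (FSeq weigh (FSeq count_resources (FSeq count_agents
       (FCond (Less (Var 12) (Var 11)) (FAssign 9 (Num 0) (Num 0)) FSkip)))))"

definition reset :: for_com where
  "reset =
     FSeq (FAssign 14 (Num 0) (Var 25))
     (FSeq (FAssign 15 (Num 0) (Num 0))
     (FSeq (FAssign 16 (Num 0) (Num 0))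
           (For 22 1 (FSeq (FAssign 17 (Var 22) (Cell 6 (Var 22)))
                           (FAssign 18 (Var 22) (Num 0))))))"

text \<open>Greedy binary expansion: LQ positions come in order of decreasing weight, so subtracting
  each weight that fits reads off the digits of the guess.\<close>

definition decode :: for_com where
  "decode =
     For 22 1 (FCond (Conj (lq_at (Var 22)) (Le (Cell 10 (Var 22)) (Var 14)))
       (FSeq (FAssign 14 (Num 0) (Minus (Var 14) (Cell 10 (Var 22))))
       (FSeq (FAssign 17 (Cell 7 (Var 22)) (Var 22))
             (FAssign 18 (Cell 7 (Var 22)) (Num 1)))) FSkip)"

definition held_at :: "aexp \<Rightarrow> bexp" where
  "held_at e = Conj (Less (Num 0) (Cell 8 e)) (Eq (Cell 17 (Cell 7 e)) e)"

text \<open>The test \<open>Less (Num 0) (Num (if m then 1 else 0))\<close> stands for the Boolean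
  \<open>m\<close>, since \<open>bexp\<close> has no constants.\<close>

definition challenge :: "bool \<Rightarrow> for_com" where
  "challenge m =
     For 24 1 (FCond
       (Conj (Less (Num 0) (Cell 8 (Var 24)))
       (Conj (Eq (Cell 0 (Var 24)) (Cell 0 (Var 23)))
       (Conj (Less (Cell 8 (Var 24)) (Cell 8 (Var 23)))
       (Conj (Le (Var 24) (Cell 17 (Cell 7 (Var 24))))
             (Or (Less (Num 0) (Num (if m then 1 else 0)))
             (Or (Eq (Cell 18 (Cell 7 (Var 24))) (Num 0))
                 (Eq (Var 24) (Cell 17 (Cell 7 (Var 24))))))))))
       (FAssign 19 (Num 0) (Num 1)) FSkip)"

definition advance_step :: "bool \<Rightarrow> for_com" where
  "advance_step m =
     FCond (held_at (Var 23))
       (FSeq (FAssign 19 (Num 0) (Num 0))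
       (FSeq (challenge m)
             (FCond (Less (Num 0) (Var 19))
                (FCond (Eq (Cell 18 (Cell 7 (Var 23))) (Num 0))
                   (FAssign 17 (Cell 7 (Var 23)) (Plus (Var 23) (Num 1)))
                   (FAssign 15 (Num 0) (Num 1)))
                FSkip))) FSkip"

definition sweep :: "bool \<Rightarrow> for_com" where
  "sweep m = For 23 1 (advance_step m)"

text \<open>Unless a failure is flagged, a sweep that starts from unsettled pointers passes a new
  edge position. There are fewer of these than input words, so that many sweeps suffice.\<close>

definition settle :: "bool \<Rightarrow> for_com" where
  "settle m = For 22 1 (sweep m)"

definition cover_search :: for_com where
  "cover_search =
     For 23 1 (FCond (Conj (held_at (Var 23)) (Eq (Cell 0 (Var 23)) (Var 22)))
       (FAssign 19 (Num 0) (Num 1)) FSkip)"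

definition cover_check :: for_com where
  "cover_check =
     For 22 1 (FCond (lq_resource_at (Var 22))
       (FSeq (FAssign 19 (Num 0) (Num 0))
       (FSeq cover_search
             (FCond (Less (Num 0) (Var 19)) FSkip (FAssign 15 (Num 0) (Num 1))))) FSkip)"

definition measure_size :: for_com where
  "measure_size =
     For 22 1 (FCond (held_at (Var 22)) (FAssign 16 (Num 0) (Plus (Var 16) (Num 1))) FSkip)"

definition clear_best :: for_com where
  "clear_best = For 22 1 (FAssign 21 (Var 22) (Num 0))"

definition copy_best :: for_com where
  "copy_best =
     For 22 1 (FCond (held_at (Var 22))
       (FAssign 21 (Cell 7 (Var 22)) (Plus (Cell 0 (Var 22)) (Num 1))) FSkip)"

text \<open>Sizes are stored plus one: 0 means that nothing has been found, and even an empty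
  matching beats it.\<close>

definition record_best :: for_com where
  "record_best =
     FCond (Conj (Eq (Var 15) (Num 0)) (Less (Var 20) (Plus (Var 16) (Num 1))))
       (FSeq (FAssign 20 (Num 0) (Plus (Var 16) (Num 1))) (FSeq clear_best copy_best)) FSkip"

definition try_guess :: "bool \<Rightarrow> for_com" where
  "try_guess m =
     FSeq reset (FSeq decode (FSeq (settle m)
       (FSeq cover_check (FSeq measure_size record_best))))"

definition search :: "bool \<Rightarrow> for_com" where
  "search m = For 25 9 (try_guess m)"

text \<open>Array 21 is indexed by list number, that is, agent plus one, so copying it cell by cell
  puts each agent's word in its place behind the leading word of the output.\<close>

definition write_result :: for_com where
  "write_result =
     FSeq (For 22 1 (FAssign 0 (Var 22) (Cell 21 (Var 22))))
       (FCond (Less (Num 0) (Var 20)) (FAssign 0 (Num 0) (Num 1)) (FAssign 0 (Num 0) (Num 0)))"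

text \<open>Kept apart from \<open>write_result\<close>, where array 1 bounds the loop and so must
  not be written.\<close>

definition write_length :: for_com where
  "write_length =
     FCond (Less (Num 0) (Var 20))
       (FAssign 1 (Num 0) (Plus (Var 2) (Num 1))) (FAssign 1 (Num 0) (Num 1))"

text \<open>Composed on the level of \<open>com\<close>: \<open>prepare\<close> computes the bound
  of the search loop, so a single \<open>for_com\<close> would violate
  \<open>bounds c \<inter> writes c = {}\<close>.\<close>

definition solver :: "bool \<Rightarrow> com" where
  "solver m = Seq (compile prepare)
     (Seq (compile (search m)) (Seq (compile write_result) (compile write_length)))"

lemmas step_defs = parse_step_def parse_def rank_step_def rank_def lq_at_def weigh_step_def
  weigh_def lq_resource_at_def count_resources_def count_agents_def reset_def decode_def held_at_def
  challenge_def advance_step_def sweep_def settle_def cover_search_def cover_check_def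
  measure_size_def clear_best_def copy_best_def record_best_def try_guess_def

section \<open>Searching for a best matching\<close>

text \<open>\<open>res 1\<close> is the word for the number of resources and
  \<open>res (2 + b)\<close> the quota of \<open>b\<close>. At an edge position the resource is
  known to be in range, hence the two forms of the quota test. The weights are a bare parameter, as
  the loop computing them is verified within the same locale.\<close>

locale loaded_instance = edge_positions I "\<lambda>p. 0 < rnk p" own res rnk start
  for I own res rnk start +
  fixes n :: nat and wt :: "nat \<Rightarrow> nat"
  assumes n_pos: "0 < n"
    and pos_bounds: "0 < rnk p \<Longrightarrow> 0 < p \<and> p < n"
    and own_less: "0 < rnk p \<Longrightarrow> own p < n"
    and lq_iff: "b < res 1 \<and> res (2 + b) = 1 \<longleftrightarrow> b \<in> lq_resources I"
    and lq_at_iff: "0 < rnk p \<Longrightarrow> res (2 + res p) = 1 \<longleftrightarrow> res p \<in> lq_resources I"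
    and lq_less: "b \<in> lq_resources I \<Longrightarrow> b < n"
begin

definition loaded :: "store \<Rightarrow> bool" where
  "loaded s \<longleftrightarrow> s 0 = res \<and> s 1 0 = n \<and> s 6 = start \<and> s 7 = own \<and> s 8 = rnk \<and> s 10 = wt"

lemma loadedD:
  assumes "loaded s"
  shows "s 0 = res" "s (Suc 0) 0 = n" "s 6 = start" "s 7 = own" "s 8 = rnk" "s 10 = wt"
  using assms by (auto simp: loaded_def)

lemma loaded_cong:
  "loaded s \<Longrightarrow> (\<And>x. x \<in> {0, 1, 6, 7, 8, 10} \<Longrightarrow> s' x = s x) \<Longrightarrow> loaded s'"
  by (simp add: loaded_def)

lemma lq_pos_iff: "lq_pos p \<longleftrightarrow> 0 < rnk p \<and> res (2 + res p) = 1"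
  using lq_at_iff by (auto simp: lq_pos_def)

section \<open>Numbers as sets of LQ positions\<close>

definition lq_from :: "nat \<Rightarrow> nat list" where
  "lq_from k = filter lq_pos [k..<n]"

fun chosen :: "nat list \<Rightarrow> nat \<Rightarrow> nat set" where
  "chosen [] g = {}"
| "chosen (p # ps) g = (if wt p \<le> g then insert p (chosen ps (g - wt p)) else chosen ps g)"

lemma lq_from_step: "k < n \<Longrightarrow> lq_from k = (if lq_pos k then k # lq_from (Suc k) else lq_from (Suc k))"
  by (simp add: lq_from_def upt_conv_Cons)

lemma lq_from_n [simp]: "lq_from n = []"
  by (simp add: lq_from_def)

lemma chosen_lq_from: "k \<le> n \<Longrightarrow> chosen (lq_from k) g \<subseteq> {p. lq_pos p \<and> k \<le> p}"
proof (induction k arbitrary: g rule: inc_induct)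
  case (step k)
  have "chosen (lq_from (Suc k)) g' \<subseteq> {p. lq_pos p \<and> k \<le> p}" for g'
    using step.IH[of g'] by auto
  then show ?case by (simp add: lq_from_step[OF step.hyps(2)])
qed simp

text \<open>With these weights \<open>chosen\<close> reads \<open>g\<close> as a binary numeral with
  one digit per LQ position, the first position carrying the leading digit.\<close>

lemma chosen_surj:
  assumes "\<And>p. lq_pos p \<Longrightarrow> wt p = 2 ^ length (lq_from (Suc p))"
    and "k \<le> n" "S \<subseteq> {p. lq_pos p \<and> k \<le> p}"
  shows "\<exists>g < 2 ^ length (lq_from k). chosen (lq_from k) g = S"
  using assms(2,3)
proof (induction k arbitrary: S rule: inc_induct)
  case base
  have "p \<notin> S" for p
    using base pos_bounds[of p] by (auto simp: lq_pos_def dest!: subsetD[of S _ p])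
  then have "S = {}" by blast
  then show ?case by simp
next
  case (step k)
  have "S - {k} \<subseteq> {p. lq_pos p \<and> Suc k \<le> p}"
    using step.prems by (auto simp: Suc_le_eq le_less)
  from step.IH[OF this] obtain g where
    g: "g < 2 ^ length (lq_from (Suc k))" "chosen (lq_from (Suc k)) g = S - {k}" by blast
  show ?case
  proof (cases "lq_pos k")
    case False
    then have "k \<notin> S" using step.prems by auto
    then show ?thesis using g step.hyps False by (auto simp: lq_from_step)
  next
    case True
    \<comment> \<open>Adding \<open>wt k\<close> sets the leading digit; if \<open>k\<close> is left
      out, \<open>g < wt k\<close> makes the greedy choice skip it.\<close>
    show ?thesis
    proof (cases "k \<in> S")
      case kS: True
      then show ?thesis
        using g step.hyps True assms(1)[OF True]
        by (intro exI[of _ "wt k + g"]) (auto simp: lq_from_step)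
    next
      case False
      then show ?thesis
        using g step.hyps True assms(1)[OF True]
        by (intro exI[of _ g]) (auto simp: lq_from_step)
    qed
  qed
qed

lemma reset_sem:
  assumes "loaded s"
  shows "sem reset s 14 0 = s 25 0" "sem reset s 15 0 = 0" "sem reset s 16 0 = 0"
    "\<And>i. i < n \<Longrightarrow> sem reset s 17 i = start i \<and> sem reset s 18 i = 0"
proof -
  note L = loadedD[OF assms]
  let ?c = "FSeq (FAssign 17 (Var 22) (Cell 6 (Var 22))) (FAssign 18 (Var 22) (Num 0))"
  define t where "t = (s(14 := (s 14)(0 := s 25 0), 15 := (s 15)(0 := 0), 16 := (s 16)(0 := 0)))"
  have r: "sem reset s = sem (For 22 1 ?c) t"
    by (simp add: reset_def t_def)
  have t: "t (Suc 0) 0 = n" "t 6 = start" using L by (auto simp: t_def)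
  have "\<forall>i < t 1 0. sem (For 22 1 ?c) t 17 i = start i \<and> sem (For 22 1 ?c) t 18 i = 0"
    by (rule For_invariant[where Inv = "\<lambda>j s. \<forall>i<j. s 17 i = start i \<and> s 18 i = 0"])
      (auto simp: t less_Suc_eq)
  then show "\<And>i. i < n \<Longrightarrow> sem reset s 17 i = start i \<and> sem reset s 18 i = 0"
    using r t by simp
  show "sem reset s 14 0 = s 25 0" "sem reset s 15 0 = 0" "sem reset s 16 0 = 0"
    unfolding r by (subst sem_frame; simp add: t_def)+
qed

lemma decode_sem:
  assumes "loaded s" "\<And>i. i < n \<Longrightarrow> s 17 i = start i \<and> s 18 i = 0"
  shows "guessed (chosen (lq_from 0) (s 14 0)) (sem decode s 17) (sem decode s 18)"
proof -
  note L = loadedD[OF assms(1)]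
  \<comment> \<open>\<open>D\<close> is what has been decoded so far; the rest of the guess is still
    encoded in cell 14.\<close>
  let ?Inv = "\<lambda>j s'. \<exists>D. chosen (lq_from 0) (s 14 0) = D \<union> chosen (lq_from j) (s' 14 0) \<and>
    guessed D (s' 17) (s' 18)"
  have "?Inv (s 1 0) (sem decode s)"
    unfolding decode_def
  proof (rule For_invariant[where Inv = ?Inv])
    show "?Inv 0 (set_counter 22 0 s)"
      using assms(2) own_less by (auto simp: guessed_def)
  next
    fix j s' assume j: "j < s 1 0" "s' 22 0 = j"
      and fr: "\<And>x. x \<notin> writes (For 22 1 (FCond (Conj (lq_at (Var 22)) (Le (Cell 10 (Var 22)) (Var 14)))
       (FSeq (FAssign 14 (Num 0) (Minus (Var 14) (Cell 10 (Var 22))))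
       (FSeq (FAssign 17 (Cell 7 (Var 22)) (Var 22))
             (FAssign 18 (Cell 7 (Var 22)) (Num 1)))) FSkip)) \<Longrightarrow> s' x = s x"
      and "?Inv j s'"
    then obtain D where D: "chosen (lq_from 0) (s 14 0) = D \<union> chosen (lq_from j) (s' 14 0)"
      "guessed D (s' 17) (s' 18)" by blast
    have L': "s' 0 = res" "s' 7 = own" "s' 8 = rnk" "s' 10 = wt" "s' (Suc 0) 0 = n"
      using L fr by simp_all
    have jn: "j < n" using j L by simp
    show "?Inv (Suc j) (set_counter 22 (Suc j) (sem (FCond (Conj (lq_at (Var 22)) (Le (Cell 10 (Var 22)) (Var 14)))
       (FSeq (FAssign 14 (Num 0) (Minus (Var 14) (Cell 10 (Var 22))))
       (FSeq (FAssign 17 (Cell 7 (Var 22)) (Var 22))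
             (FAssign 18 (Cell 7 (Var 22)) (Num 1)))) FSkip) s'))"
    proof (cases "lq_pos j \<and> wt j \<le> s' 14 0")
      case True
      have G: "guessed (insert j D) ((s' 17)(own j := j)) ((s' 18)(own j := 1))"
        unfolding guessed_def
      proof (intro allI impI)
        fix p assume "0 < rnk p"
        with D(2) have "s' 17 (own p) \<in> D \<and> own (s' 17 (own p)) = own p \<and> s' 18 (own p) \<noteq> 0 \<or>
          (\<forall>p' \<in> D. own p' \<noteq> own p) \<and> s' 17 (own p) = start (own p) \<and> s' 18 (own p) = 0"
          unfolding guessed_def by blast
        then show "((s' 17)(own j := j)) (own p) \<in> insert j D \<and>
            own (((s' 17)(own j := j)) (own p)) = own p \<and> ((s' 18)(own j := 1)) (own p) \<noteq> 0 \<or>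
          (\<forall>p' \<in> insert j D. own p' \<noteq> own p) \<and>
            ((s' 17)(own j := j)) (own p) = start (own p) \<and> ((s' 18)(own j := 1)) (own p) = 0"
          by (cases "own p = own j") auto
      qed
      show ?thesis
        using True D(1) L' j jn G[unfolded fun_upd_def One_nat_def]
        by (intro exI[of _ "insert j D"]) (simp add: lq_at_def lq_pos_iff lq_from_step[OF jn])
    next
      case False
      then show ?thesis
        using D L' j jn
        by (intro exI[of _ D]) (auto simp: lq_at_def lq_pos_iff lq_from_step[OF jn])
    qed
  qed simp
  then show ?thesis using L by simp
qed

section \<open>Sweeping until the pointers settle\<close>

lemma challenge_sem:
  assumes "loaded s" "s 19 0 = 0"
  shows "0 < sem (challenge m) s 19 0 \<longleftrightarrow> challenged m (s 18) (s 17) (s 23 0)"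
proof -
  note L = loadedD[OF assms(1)]
  define C where "C p' \<longleftrightarrow> 0 < rnk p' \<and> res p' = res (s 23 0) \<and> rnk p' < rnk (s 23 0) \<and>
     p' \<le> s 17 (own p') \<and> (m \<or> s 18 (own p') = 0 \<or> p' = s 17 (own p'))" for p'
  have "0 < sem (challenge m) s 19 0 \<longleftrightarrow> (\<exists>p' < s 1 0. C p')"
    unfolding challenge_def
    by (rule For_invariant[where Inv = "\<lambda>j s'. 0 < s' 19 0 \<longleftrightarrow> (\<exists>p' < j. C p')"])
      (use assms(2) in \<open>auto simp: L C_def less_Suc_eq split: if_splits\<close>)
  moreover have "challenged m (s 18) (s 17) (s 23 0) \<longleftrightarrow> (\<exists>p' < s 1 0. C p')"
    using L pos_bounds unfolding challenged_def C_def by auto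
  ultimately show ?thesis by simp
qed

text \<open>The certificate behind the failure flag. Speaking of reachability, it can be traced back
  to the initial pointers, where \<open>guessed_complete\<close> refutes it for the right
  guess.\<close>

definition stuck :: "bool \<Rightarrow> (nat \<Rightarrow> nat) \<Rightarrow> (nat \<Rightarrow> nat) \<Rightarrow> bool" where
  "stuck m fx ptr \<longleftrightarrow> (\<exists>ptr' p. (adv m fx)\<^sup>*\<^sup>* ptr ptr' \<and> held ptr' p \<and> challenged m fx ptr' p \<and>
     fx (own p) \<noteq> 0)"

lemma stuck_trans: "(adv m fx)\<^sup>*\<^sup>* ptr ptr' \<Longrightarrow> stuck m fx ptr' \<Longrightarrow> stuck m fx ptr"
  unfolding stuck_def by (meson rtranclp_trans)

definition passed :: "(nat \<Rightarrow> nat) \<Rightarrow> nat set" where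
  "passed ptr = {p. 0 < rnk p \<and> p < ptr (own p)}"

lemma finite_passed: "finite (passed ptr)"
  by (rule finite_subset[OF _ finite_pos]) (auto simp: passed_def)

lemma card_passed_less: "card (passed ptr) < n"
proof -
  \<comment> \<open>Position 0 is no edge position, which makes the bound strict.\<close>
  have "card (passed ptr) \<le> card {0<..<n}"
    by (rule card_mono) (use pos_bounds in \<open>auto simp: passed_def\<close>)
  then show ?thesis using n_pos by simp
qed

lemma passed_adv:
  assumes "held ptr p"
  shows "card (passed ptr) < card (passed (ptr(own p := Suc p)))"
proof (rule psubset_card_mono[OF finite_passed])
  have "p \<notin> passed ptr" "p \<in> passed (ptr(own p := Suc p))"
    using assms by (auto simp: passed_def held_def)
  moreover have "passed ptr \<subseteq> passed (ptr(own p := Suc p))"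
    using assms by (auto simp: passed_def held_def)
  ultimately show "passed ptr \<subset> passed (ptr(own p := Suc p))" by blast
qed

text \<open>As long as no pointer has moved, the checks made at positions below \<open>j\<close>
  concern the current state and stay valid; once one has moved, only the growth of
  \<open>passed\<close> is remembered.\<close>

definition progress :: "bool \<Rightarrow> nat \<Rightarrow> store \<Rightarrow> store \<Rightarrow> bool" where
  "progress m j s s' \<longleftrightarrow> (adv m (s 18))\<^sup>*\<^sup>* (s 17) (s' 17) \<and>
     (s 15 0 \<noteq> 0 \<longrightarrow> s' 15 0 \<noteq> 0) \<and> (s' 15 0 \<noteq> 0 \<longrightarrow> s 15 0 \<noteq> 0 \<or> stuck m (s 18) (s 17)) \<and>
     (s' 15 0 = 0 \<longrightarrow>
        (s' 17 = s 17 \<and> (\<forall>p<j. held (s 17) p \<longrightarrow> \<not> challenged m (s 18) (s 17) p)) \<or>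
        card (passed (s 17)) < card (passed (s' 17)))"

lemma advance_step_sem:
  assumes "loaded s"
  shows "sem (advance_step m) s 17 =
      (if held (s 17) (s 23 0) \<and> challenged m (s 18) (s 17) (s 23 0) \<and> s 18 (own (s 23 0)) = 0
       then (s 17)(own (s 23 0) := Suc (s 23 0)) else s 17)" (is ?A)
    and "sem (advance_step m) s 15 0 =
      (if held (s 17) (s 23 0) \<and> challenged m (s 18) (s 17) (s 23 0) \<and> s 18 (own (s 23 0)) \<noteq> 0
       then 1 else s 15 0)" (is ?B)
proof -
  note L = loadedD[OF assms]
  define t where "t = s(19 := (s 19)(0 := 0))"
  have t: "loaded t" "t 19 0 = 0" using assms by (auto simp: t_def loaded_def)
  note C = challenge_sem[OF t, of m]
  have f: "sem (challenge m) t x = s x" if "x \<notin> {19, 24}" for x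
    using that by (subst sem_frame) (auto simp: challenge_def t_def)
  have t': "t 18 = s 18" "t 17 = s 17" "t 23 = s 23" by (auto simp: t_def)
  have "bval (held_at (Var 23)) s \<longleftrightarrow> held (s 17) (s 23 0)"
    by (simp add: held_at_def L held_def)
  then have "sem (advance_step m) s =
    (if held (s 17) (s 23 0)
     then sem (FCond (Less (Num 0) (Var 19))
                (FCond (Eq (Cell 18 (Cell 7 (Var 23))) (Num 0))
                   (FAssign 17 (Cell 7 (Var 23)) (Plus (Var 23) (Num 1)))
                   (FAssign 15 (Num 0) (Num 1)))
                FSkip) (sem (challenge m) t)
     else s)"
    by (simp add: advance_step_def t_def)
  then show ?A ?B
    using C by (auto simp: f t' L)
qed

lemma sweep_sem:
  assumes "loaded s"
  shows "progress m n s (sem (sweep m) s)"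
proof -
  note L = loadedD[OF assms]
  have "progress m (s 1 0) s (sem (sweep m) s)"
    unfolding sweep_def
  proof (rule For_invariant[where Inv = "\<lambda>j. progress m j s"])
    show "23 \<notin> writes (advance_step m)" by (simp add: advance_step_def challenge_def)
    show "progress m 0 s (set_counter 23 0 s)" by (simp add: progress_def)
  next
    fix j s' assume j: "j < s 1 0" "s' 23 0 = j"
      and fr: "\<And>x. x \<notin> writes (For 23 1 (advance_step m)) \<Longrightarrow> s' x = s x"
      and P: "progress m j s s'"
    have fr': "s' x = s x" if "x \<notin> {15, 17, 19, 23, 24}" for x
      using that by (intro fr) (auto simp: advance_step_def challenge_def)
    have "loaded s'" by (rule loaded_cong[OF assms]) (auto intro: fr')
    note A = advance_step_sem[OF this, of m, unfolded j(2)]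
    have fx: "s' 18 = s 18" by (simp add: fr')
    let ?t = "set_counter 23 (Suc j) (sem (advance_step m) s')"
    have t: "?t 17 = sem (advance_step m) s' 17" "?t 15 = sem (advance_step m) s' 15" by simp_all
    from P have adv: "(adv m (s 18))\<^sup>*\<^sup>* (s 17) (s' 17)"
      and failed: "s 15 0 \<noteq> 0 \<longrightarrow> s' 15 0 \<noteq> 0"
      and fail: "s' 15 0 \<noteq> 0 \<longrightarrow> s 15 0 \<noteq> 0 \<or> stuck m (s 18) (s 17)"
      and pr: "s' 15 0 = 0 \<longrightarrow>
        (s' 17 = s 17 \<and> (\<forall>p<j. held (s 17) p \<longrightarrow> \<not> challenged m (s 18) (s 17) p)) \<or>
        card (passed (s 17)) < card (passed (s' 17))"
      unfolding progress_def by auto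
    show "progress m (Suc j) s ?t"
    proof (cases "held (s' 17) j \<and> challenged m (s 18) (s' 17) j")
      case False
      then have "sem (advance_step m) s' 17 = s' 17" "sem (advance_step m) s' 15 0 = s' 15 0"
        using A by (auto simp: fx)
      then show ?thesis
        using adv failed fail pr False unfolding progress_def t by (auto simp: less_Suc_eq)
    next
      case bad: True
      show ?thesis
      proof (cases "s 18 (own j) = 0")
        case True
        have e: "sem (advance_step m) s' 17 = (s' 17)(own j := Suc j)"
          "sem (advance_step m) s' 15 0 = s' 15 0"
          using A bad True by (auto simp: fx)
        have "adv m (s 18) (s' 17) ((s' 17)(own j := Suc j))"
          using bad True unfolding adv_def by blast
        then have "(adv m (s 18))\<^sup>*\<^sup>* (s 17) ((s' 17)(own j := Suc j))"
          using adv by (rule rtranclp.rtrancl_into_rtrancl[rotated])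
        moreover have "card (passed (s' 17)) < card (passed ((s' 17)(own j := Suc j)))"
          using passed_adv bad by blast
        ultimately show ?thesis
          using failed fail pr unfolding progress_def t e by auto
      next
        case False
        have e: "sem (advance_step m) s' 17 = s' 17" "sem (advance_step m) s' 15 0 = 1"
          using A bad False by (auto simp: fx)
        have "stuck m (s 18) (s 17)"
          using adv bad False unfolding stuck_def by blast
        then show ?thesis using adv unfolding progress_def t e by auto
      qed
    qed
  qed
  then show ?thesis using L by simp
qed

lemma settle_sem:
  assumes "loaded s" "s 15 0 = 0"
  shows "(adv m (s 18))\<^sup>*\<^sup>* (s 17) (sem (settle m) s 17)"
    and "sem (settle m) s 15 0 \<noteq> 0 \<Longrightarrow> stuck m (s 18) (s 17)"
    and "sem (settle m) s 15 0 = 0 \<Longrightarrow> settled m (s 18) (sem (settle m) s 17)"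
proof -
  note L = loadedD[OF assms(1)]
  \<comment> \<open>Without a failure, after \<open>k\<close> sweeps the pointers are settled or at
    least \<open>k\<close> positions have been passed; the latter is impossible for
    \<open>k = n\<close>.\<close>
  let ?Inv = "\<lambda>k s'. (adv m (s 18))\<^sup>*\<^sup>* (s 17) (s' 17) \<and>
    (s' 15 0 \<noteq> 0 \<longrightarrow> stuck m (s 18) (s 17)) \<and>
    (s' 15 0 = 0 \<longrightarrow> settled m (s 18) (s' 17) \<or> k \<le> card (passed (s' 17)))"
  have "?Inv (s 1 0) (sem (settle m) s)"
    unfolding settle_def
  proof (rule For_invariant[where Inv = ?Inv])
    show "22 \<notin> writes (sweep m)" by (simp add: sweep_def advance_step_def challenge_def)
    show "?Inv 0 (set_counter 22 0 s)" using assms(2) by simp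
  next
    fix j s' assume j: "j < s 1 0" "s' 22 0 = j"
      and fr: "\<And>x. x \<notin> writes (For 22 1 (sweep m)) \<Longrightarrow> s' x = s x"
      and I: "?Inv j s'"
    have fr': "s' x = s x" if "x \<notin> {15, 17, 19, 22, 23, 24}" for x
      using that by (intro fr) (auto simp: sweep_def advance_step_def challenge_def)
    have "loaded s'" by (rule loaded_cong[OF assms(1)]) (auto intro: fr')
    note S = sweep_sem[OF this, of m]
    let ?u = "sem (sweep m) s'"
    have fx: "s' 18 = s 18" by (simp add: fr')
    from S have adv: "(adv m (s 18))\<^sup>*\<^sup>* (s' 17) (?u 17)"
      and failed: "s' 15 0 \<noteq> 0 \<longrightarrow> ?u 15 0 \<noteq> 0"
      and fail: "?u 15 0 \<noteq> 0 \<longrightarrow> s' 15 0 \<noteq> 0 \<or> stuck m (s 18) (s' 17)"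
      and pr: "?u 15 0 = 0 \<longrightarrow>
        (?u 17 = s' 17 \<and> (\<forall>p<n. held (s' 17) p \<longrightarrow> \<not> challenged m (s 18) (s' 17) p)) \<or>
        card (passed (s' 17)) < card (passed (?u 17))"
      unfolding progress_def fx by auto
    have "(adv m (s 18))\<^sup>*\<^sup>* (s 17) (?u 17)" using I adv by (meson rtranclp_trans)
    moreover have "?u 15 0 \<noteq> 0 \<longrightarrow> stuck m (s 18) (s 17)"
      using fail I stuck_trans by blast
    moreover have "settled m (s 18) (?u 17) \<or> Suc j \<le> card (passed (?u 17))" if "?u 15 0 = 0"
    proof (cases "card (passed (s' 17)) < card (passed (?u 17))")
      case False
      with pr that have e: "?u 17 = s' 17"
        and "\<forall>p<n. held (s' 17) p \<longrightarrow> \<not> challenged m (s 18) (s' 17) p" by auto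
      then have "settled m (s 18) (?u 17)"
        using pos_bounds unfolding settled_def e by (auto simp: held_def)
      then show ?thesis by simp
    next
      case True
      then have ne: "?u 17 \<noteq> s' 17" by auto
      show ?thesis
      proof (cases "settled m (s 18) (s' 17)")
        case st: True
        \<comment> \<open>Settled pointers admit no advance, so a sweep cannot have changed
          them.\<close>
        have "\<not> adv m (s 18) (s' 17) p" for p using st unfolding adv_def settled_def by blast
        then have "?u 17 = s' 17" using adv by (metis converse_rtranclpE)
        then show ?thesis using ne by simp
      next
        case False
        show ?thesis
        proof (cases "s' 15 0 = 0")
          case True
          then show ?thesis using I False \<open>card (passed (s' 17)) < card (passed (?u 17))\<close> by auto
        next
          case f: False
          then show ?thesis using failed that by simp
        qed
      qed
    qed
    ultimately show "?Inv (Suc j) (set_counter 22 (Suc j) ?u)" by simp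
  qed
  then show "(adv m (s 18))\<^sup>*\<^sup>* (s 17) (sem (settle m) s 17)"
    and "sem (settle m) s 15 0 \<noteq> 0 \<Longrightarrow> stuck m (s 18) (s 17)"
    and "sem (settle m) s 15 0 = 0 \<Longrightarrow> settled m (s 18) (sem (settle m) s 17)"
    using L(2) card_passed_less[of "sem (settle m) s 17"] by auto
qed

section \<open>Checking, measuring and recording the result of a guess\<close>

lemma cover_search_sem:
  assumes "loaded s" "s 19 0 = 0"
  shows "0 < sem cover_search s 19 0 \<longleftrightarrow> (\<exists>p. held (s 17) p \<and> res p = s 22 0)"
proof -
  note L = loadedD[OF assms(1)]
  have "0 < sem cover_search s 19 0 \<longleftrightarrow> (\<exists>p < s 1 0. held (s 17) p \<and> res p = s 22 0)"
    unfolding cover_search_def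
    by (rule For_invariant[where
          Inv = "\<lambda>j s'. 0 < s' 19 0 \<longleftrightarrow> (\<exists>p < j. held (s 17) p \<and> res p = s 22 0)"])
      (use assms(2) in \<open>auto simp: L held_at_def held_def less_Suc_eq split: if_splits\<close>)
  then show ?thesis using L(2) pos_bounds by (auto simp: held_def)
qed

lemma cover_check_sem:
  assumes "loaded s"
  shows "sem cover_check s 15 0 = 0 \<longleftrightarrow> s 15 0 = 0 \<and> covers (s 17)"
proof -
  note L = loadedD[OF assms]
  let ?c = "FCond (lq_resource_at (Var 22))
       (FSeq (FAssign 19 (Num 0) (Num 0))
       (FSeq cover_search
             (FCond (Less (Num 0) (Var 19)) FSkip (FAssign 15 (Num 0) (Num 1))))) FSkip"
  let ?Q = "\<lambda>b. b \<in> lq_resources I \<longrightarrow> (\<exists>p. held (s 17) p \<and> res p = b)"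
  let ?Inv = "\<lambda>j s'. s' 15 0 = 0 \<longleftrightarrow> s 15 0 = 0 \<and> (\<forall>b<j. ?Q b)"
  have "?Inv (s 1 0) (sem cover_check s)"
    unfolding cover_check_def
  proof (rule For_invariant[where Inv = ?Inv])
    show "22 \<notin> writes ?c" by (simp add: cover_search_def)
    show "?Inv 0 (set_counter 22 0 s)" by simp
  next
    fix j s' assume j: "j < s 1 0" "s' 22 0 = j"
      and fr: "\<And>x. x \<notin> writes (For 22 1 ?c) \<Longrightarrow> s' x = s x" and I: "?Inv j s'"
    have fr': "s' x = s x" if "x \<notin> {15, 19, 22, 23}" for x
      using that by (intro fr) (auto simp: cover_search_def)
    have ld: "loaded s'" by (rule loaded_cong[OF assms]) (auto intro: fr')
    note L' = loadedD[OF ld]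
    define t where "t = s'(19 := (s' 19)(0 := 0))"
    have t: "loaded t" "t 19 0 = 0" "t 17 = s 17" "t 22 0 = j"
      using ld fr' j by (auto simp: t_def loaded_def)
    note C = cover_search_sem[OF t(1,2), unfolded t(3,4)]
    have f: "sem cover_search t 15 = s' 15"
      by (subst sem_frame) (auto simp: cover_search_def t_def)
    have b: "bval (lq_resource_at (Var 22)) s' \<longleftrightarrow> j \<in> lq_resources I"
      using lq_iff[of j] j L' by (simp add: lq_resource_at_def)
    have "sem ?c s' 15 0 = (if j \<in> lq_resources I \<and> \<not> (\<exists>p. held (s 17) p \<and> res p = j) then 1 else s' 15 0)"
      using b C f by (auto simp add: t_def[symmetric])
    then show "?Inv (Suc j) (set_counter 22 (Suc j) (sem ?c s'))"
      using I by (auto simp: less_Suc_eq simp del: sem.simps)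
  qed
  then show ?thesis using L(2) lq_less by (auto simp: covers_def)
qed

lemma measure_size_sem:
  assumes "loaded s" "s 16 0 = 0"
  shows "sem measure_size s 16 0 = card {p. held (s 17) p}"
proof -
  note L = loadedD[OF assms(1)]
  have S: "{p. p < Suc j \<and> held ptr p} =
    (if held ptr j then insert j {p. p < j \<and> held ptr p} else {p. p < j \<and> held ptr p})" for j ptr
    by (auto simp: less_Suc_eq)
  have "sem measure_size s 16 0 = card {p. p < s 1 0 \<and> held (s 17) p}"
    unfolding measure_size_def
    by (rule For_invariant[where Inv = "\<lambda>j s'. s' 16 0 = card {p. p < j \<and> held (s 17) p}"])
      (use assms(2) in \<open>simp_all add: L held_at_def S, simp_all add: held_def L\<close>)
  moreover have "{p. p < s 1 0 \<and> held (s 17) p} = {p. held (s 17) p}"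
    using L(2) pos_bounds by (auto simp: held_def)
  ultimately show ?thesis by simp
qed

definition recorded :: "(nat \<times> nat) set \<Rightarrow> (nat \<Rightarrow> nat) \<Rightarrow> bool" where
  "recorded M bp \<longleftrightarrow> (\<forall>a. Suc a < n \<longrightarrow>
     bp (Suc a) = (case agent_partner M a of None \<Rightarrow> 0 | Some b \<Rightarrow> Suc b))"

lemma agent_partner_matching_of:
  assumes "matching I (matching_of ptr)"
  shows "agent_partner (matching_of ptr) a =
    (if held ptr (ptr (Suc a)) \<and> own (ptr (Suc a)) = Suc a then Some (res (ptr (Suc a))) else None)"
proof (cases "held ptr (ptr (Suc a)) \<and> own (ptr (Suc a)) = Suc a")
  case True
  then have "(a, res (ptr (Suc a))) \<in> matching_of ptr"
    unfolding matching_of_def by (intro image_eqI[of _ _ "ptr (Suc a)"]) auto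
  then show ?thesis using agent_partner_eq[OF assms] True by auto
next
  case False
  have "agent_partner (matching_of ptr) a \<noteq> Some b" for b
  proof
    assume "agent_partner (matching_of ptr) a = Some b"
    then have "(a, b) \<in> matching_of ptr" by (rule agent_partner_SomeD[OF assms])
    then obtain p where p: "held ptr p" "own p - 1 = a" unfolding matching_of_def by auto
    then have "own p = Suc a" using pos_Suc[of p] by (auto simp: held_def)
    then show False using False p(1) by (auto simp: held_def)
  qed
  then show ?thesis using False by (cases "agent_partner (matching_of ptr) a") auto
qed

lemma copy_best_sem:
  assumes "loaded s" "\<And>i. i < n \<Longrightarrow> s 21 i = 0" "matching I (matching_of (s 17))"
  shows "recorded (matching_of (s 17)) (sem copy_best s 21)"
proof -
  note L = loadedD[OF assms(1)]
  let ?Inv = "\<lambda>j s'. \<forall>i<n. s' 21 i =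
    (if held (s 17) (s 17 i) \<and> own (s 17 i) = i \<and> s 17 i < j then Suc (res (s 17 i)) else 0)"
  have "?Inv (s 1 0) (sem copy_best s)"
    unfolding copy_best_def
    by (rule For_invariant[where Inv = ?Inv])
      (use assms(2) own_less in \<open>auto simp: L held_at_def held_def less_Suc_eq\<close>)
  then show ?thesis
    using L(2) pos_bounds agent_partner_matching_of[OF assms(3)]
    by (auto simp: recorded_def held_def)
qed

lemma clear_best_sem: "i < s 1 0 \<Longrightarrow> sem clear_best s 21 i = 0"
proof -
  have "\<forall>i < s 1 0. sem clear_best s 21 i = 0"
    unfolding clear_best_def
    by (rule For_invariant[where Inv = "\<lambda>j s'. \<forall>i<j. s' 21 i = 0"]) (auto simp: less_Suc_eq)
  then show "i < s 1 0 \<Longrightarrow> sem clear_best s 21 i = 0" by blast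
qed

lemma record_best_sem:
  assumes "loaded s"
  shows "s 15 0 = 0 \<and> s 20 0 < Suc (s 16 0) \<Longrightarrow> sem record_best s 20 0 = Suc (s 16 0)"
    and "s 15 0 = 0 \<and> s 20 0 < Suc (s 16 0) \<Longrightarrow> matching I (matching_of (s 17)) \<Longrightarrow>
      recorded (matching_of (s 17)) (sem record_best s 21)"
    and "\<not> (s 15 0 = 0 \<and> s 20 0 < Suc (s 16 0)) \<Longrightarrow> sem record_best s = s"
proof -
  note L = loadedD[OF assms]
  define t where "t = s(20 := (s 20)(0 := Suc (s 16 0)))"
  define u where "u = sem clear_best t"
  have tu: "u x = t x" if "x \<notin> {21, 22}" for x
    unfolding u_def using that by (subst sem_frame) (auto simp: clear_best_def)
  have u: "loaded u" "u 17 = s 17" using assms by (simp_all add: loaded_def tu, simp_all add: t_def)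
  have z: "u 21 i = 0" if "i < n" for i
    unfolding u_def by (rule clear_best_sem) (use that L in \<open>simp add: t_def\<close>)
  {
    assume a: "s 15 0 = 0 \<and> s 20 0 < Suc (s 16 0)"
    then have r: "sem record_best s = sem copy_best u" by (simp add: record_best_def t_def u_def)
    have "sem copy_best u 20 = u 20" by (subst sem_frame) (auto simp: copy_best_def)
    then show "sem record_best s 20 0 = Suc (s 16 0)" using r tu by (simp add: t_def)
    assume "matching I (matching_of (s 17))"
    then show "recorded (matching_of (s 17)) (sem record_best s 21)"
      using copy_best_sem[OF u(1) z] u(2) r by simp
  }
  show "\<not> (s 15 0 = 0 \<and> s 20 0 < Suc (s 16 0)) \<Longrightarrow> sem record_best s = s"
    by (auto simp: record_best_def)
qed

text \<open>Soundness comes from \<open>settled_solution\<close> and applies to any guess.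
  Completeness comes from \<open>guessed_complete\<close>, which excludes \<open>stuck\<close> and
  with it the failure flag. As the recorded size never drops, the order of the guesses does not
  matter.\<close>

lemma try_guess_sem:
  fixes m :: bool
  assumes "loaded s"
  defines "s' \<equiv> sem (try_guess m) s"
  shows "(s' 20 0 = s 20 0 \<and> s' 21 = s 21) \<or>
      (\<exists>M. solution m I M \<and> s' 20 0 = Suc (card M) \<and> recorded M (s' 21))"
    and "s 20 0 \<le> s' 20 0"
    and "solution m I M \<Longrightarrow> lq_part M = chosen (lq_from 0) (s 25 0) \<Longrightarrow> Suc (card M) \<le> s' 20 0"
proof -
  define s1 where "s1 = sem reset s"
  define s2 where "s2 = sem decode s1"
  define s3 where "s3 = sem (settle m) s2"
  define s4 where "s4 = sem cover_check s3"
  define s5 where "s5 = sem measure_size s4"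
  have s': "s' = sem record_best s5"
    by (simp add: s'_def try_guess_def s1_def s2_def s3_def s4_def s5_def)
  have f1: "s1 x = s x" if "x \<notin> {14, 15, 16, 17, 18, 22}" for x
    unfolding s1_def using that by (subst sem_frame) (auto simp: reset_def)
  have f2: "s2 x = s1 x" if "x \<notin> {14, 17, 18, 22}" for x
    unfolding s2_def using that by (subst sem_frame) (auto simp: decode_def)
  have f3: "s3 x = s2 x" if "x \<notin> {15, 17, 19, 22, 23, 24}" for x
    unfolding s3_def using that
    by (subst sem_frame) (auto simp: settle_def sweep_def advance_step_def challenge_def)
  have f4: "s4 x = s3 x" if "x \<notin> {15, 19, 22, 23}" for x
    unfolding s4_def using that by (subst sem_frame) (auto simp: cover_check_def cover_search_def)
  have f5: "s5 x = s4 x" if "x \<notin> {16, 22}" for x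
    unfolding s5_def using that by (subst sem_frame) (auto simp: measure_size_def)
  have l1: "loaded s1" by (rule loaded_cong[OF assms(1)]) (auto intro: f1)
  have l2: "loaded s2" by (rule loaded_cong[OF l1]) (auto intro: f2)
  have l3: "loaded s3" by (rule loaded_cong[OF l2]) (auto intro: f3)
  have l4: "loaded s4" by (rule loaded_cong[OF l3]) (auto intro: f4)
  have l5: "loaded s5" by (rule loaded_cong[OF l4]) (auto intro: f5)
  let ?G = "chosen (lq_from 0) (s 25 0)"
  note r = reset_sem[OF assms(1), folded s1_def]
  have g: "guessed ?G (s2 17) (s2 18)"
    using decode_sem[OF l1 r(4), folded s2_def] r(1) by simp
  have G: "\<forall>p \<in> ?G. lq_pos p" using chosen_lq_from[of 0] by blast
  have s2: "s2 15 0 = 0" "s4 16 0 = 0" using r f2 f3 f4 by simp_all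
  note st = settle_sem[OF l2 s2(1), of m, folded s3_def]
  have fail: "s5 15 0 = 0 \<longleftrightarrow> s3 15 0 = 0 \<and> covers (s3 17)"
    using cover_check_sem[OF l3, folded s4_def] f5 by simp
  have ptr: "s5 17 = s3 17" using f5 f4 by simp
  have size: "s5 16 0 = card {p. held (s3 17) p}"
    using measure_size_sem[OF l4 s2(2), folded s5_def] f4 by simp
  have best: "s5 20 = s 20" "s5 21 = s 21" using f1 f2 f3 f4 f5 by simp_all
  note rec = record_best_sem[OF l5, folded s']
  have size_best: "s5 15 0 = 0 \<Longrightarrow> Suc (card {p. held (s3 17) p}) \<le> s' 20 0"
    using rec size by (cases "s5 20 0 < Suc (s5 16 0)") auto
  show "(s' 20 0 = s 20 0 \<and> s' 21 = s 21) \<or>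
      (\<exists>M. solution m I M \<and> s' 20 0 = Suc (card M) \<and> recorded M (s' 21))"
  proof (cases "s5 15 0 = 0 \<and> s5 20 0 < Suc (s5 16 0)")
    case True
    then have ok: "s3 15 0 = 0" "covers (s3 17)" using fail by auto
    have sol: "solution m I (matching_of (s3 17))"
      using settled_solution[OF g G st(1) st(3)[OF ok(1)] ok(2)] .
    then have "recorded (matching_of (s3 17)) (s' 21)"
      using rec(2)[OF True] ptr solution_matching by simp
    moreover have "s' 20 0 = Suc (card (matching_of (s3 17)))"
      using rec(1)[OF True] size card_matching_of by simp
    ultimately show ?thesis using sol by blast
  next
    case False
    then show ?thesis using rec(3) best by simp
  qed
  show "s 20 0 \<le> s' 20 0"
    using rec best by (cases "s5 15 0 = 0 \<and> s5 20 0 < Suc (s5 16 0)") auto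
  assume sol: "solution m I M" and M: "lq_part M = ?G"
  have g': "guessed (lq_part M) (s2 17) (s2 18)" using g M by simp
  have "\<not> stuck m (s2 18) (s2 17)"
  proof
    assume "stuck m (s2 18) (s2 17)"
    then obtain ptr p where "(adv m (s2 18))\<^sup>*\<^sup>* (s2 17) ptr" "held ptr p"
      "challenged m (s2 18) ptr p" "s2 18 (own p) \<noteq> 0" unfolding stuck_def by blast
    then show False using guessed_complete(1)[OF sol g', of ptr p] by simp
  qed
  then have "s3 15 0 = 0" using st(2) by blast
  moreover have "covers (s3 17)" by (rule guessed_complete(2)[OF sol g' st(1)])
  ultimately have "s5 15 0 = 0" using fail by simp
  then have "Suc (card {p. held (s3 17) p}) \<le> s' 20 0" by (rule size_best)
  moreover have "card M \<le> card {p. held (s3 17) p}"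
    by (rule guessed_complete(3)[OF sol g' st(1)])
  ultimately show "Suc (card M) \<le> s' 20 0" by simp
qed

text \<open>If the loop runs over all codes, the LQ part of every solution is among them, so the
  recorded size bounds all solutions and is attained. If it is cut short, there is no solution, and
  soundness alone leaves 0 in cell 20.\<close>

lemma search_sem:
  fixes m :: bool
  assumes "loaded s" "s 20 0 = 0"
    and wt: "\<And>p. lq_pos p \<Longrightarrow> wt p = 2 ^ length (lq_from (Suc p))"
    and guesses: "s 9 0 = 2 ^ length (lq_from 0) \<or> (\<nexists>M. solution m I M)"
  defines "s' \<equiv> sem (search m) s"
  shows "(s' 20 0 = 0 \<and> (\<nexists>M. solution m I M)) \<or>
    (0 < s' 20 0 \<and> (\<exists>M. max_size (solution m I) M \<and> recorded M (s' 21)))"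
proof -
  let ?Inv = "\<lambda>j s'. (s' 20 0 = 0 \<or> (\<exists>M. solution m I M \<and> s' 20 0 = Suc (card M) \<and> recorded M (s' 21))) \<and>
    (\<forall>M g. g < j \<and> solution m I M \<and> lq_part M = chosen (lq_from 0) g \<longrightarrow> Suc (card M) \<le> s' 20 0)"
  have W: "writes (try_guess m) = {14, 15, 16, 17, 18, 19, 20, 21, 22, 23, 24}"
    by (auto simp: step_defs)
  have Inv: "?Inv (s 9 0) s'"
    unfolding search_def s'_def
  proof (rule For_invariant[where Inv = ?Inv])
    show "25 \<notin> writes (try_guess m)" by (simp add: W)
    show "?Inv 0 (set_counter 25 0 s)" using assms(2) by simp
  next
    fix j s' assume j: "j < s 9 0" "s' 25 0 = j"
      and fr: "\<And>x. x \<notin> writes (For 25 9 (try_guess m)) \<Longrightarrow> s' x = s x" and I: "?Inv j s'"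
    have "loaded s'" by (rule loaded_cong[OF assms(1)]) (intro fr, auto simp: W)
    note T = try_guess_sem[OF this, of m, unfolded j(2)]
    let ?u = "sem (try_guess m) s'"
    have "?u 20 0 = 0 \<or> (\<exists>M. solution m I M \<and> ?u 20 0 = Suc (card M) \<and> recorded M (?u 21))"
      using T(1) I by metis
    moreover have "Suc (card M) \<le> ?u 20 0"
      if "g < Suc j" "solution m I M" "lq_part M = chosen (lq_from 0) g" for M g
    proof (cases "g = j")
      case True
      then show ?thesis using T(3) that by simp
    next
      case False
      then have "g < j" using that(1) by simp
      then have "Suc (card M) \<le> s' 20 0" using I that(2,3) by blast
      then show ?thesis using T(2) by simp
    qed
    ultimately show "?Inv (Suc j) (set_counter 25 (Suc j) ?u)" by simp blast
  qed
  have best: "Suc (card M) \<le> s' 20 0" if M: "solution m I M" for M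
  proof -
    have "s 9 0 = 2 ^ length (lq_from 0)" using guesses M by blast
    moreover have "\<exists>g < 2 ^ length (lq_from 0). chosen (lq_from 0) g = lq_part M"
      by (rule chosen_surj[OF wt]) (auto simp: lq_part_def)
    ultimately show ?thesis using Inv M by metis
  qed
  show ?thesis
  proof (cases "s' 20 0 = 0")
    case True
    then show ?thesis using best by fastforce
  next
    case False
    with conjunct1[OF Inv] obtain M
      where M: "solution m I M" "s' 20 0 = Suc (card M)" "recorded M (s' 21)" by auto
    then have "max_size (solution m I) M" using best by (fastforce simp: max_size_def)
    then show ?thesis using M by auto
  qed
qed

end

section \<open>Reading the instance\<close>

definition pref_lists :: "lq_instance \<Rightarrow> nat list list" where
  "pref_lists I = agent_pref I @ resource_pref I"

text \<open>The first list lies behind two size words, the quotas and its own length word, hence the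
  3. For \<open>i = length (pref_lists I)\<close> it is the start of a fictitious next list, one
  more than the input length because that list's length word is missing.\<close>

definition list_start :: "lq_instance \<Rightarrow> nat \<Rightarrow> nat" where
  "list_start I i = 3 + n_resources I + (\<Sum>j<i. Suc (length (pref_lists I ! j)))"

lemma list_start_Suc: "list_start I (Suc i) = Suc (list_start I i + length (pref_lists I ! i))"
  by (simp add: list_start_def)

lemma list_start_mono: "i \<le> j \<Longrightarrow> list_start I i \<le> list_start I j"
  unfolding list_start_def by (intro add_left_mono sum_mono2) auto

lemma list_start_less: "i < j \<Longrightarrow> list_start I i + length (pref_lists I ! i) < list_start I j"
  using list_start_mono[of "Suc i" j I] by (simp add: list_start_Suc)

lemma list_start_ge: "3 + n_resources I \<le> list_start I i"
  by (simp add: list_start_def)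

lemma length_concat_blocks:
  "length (concat (map (\<lambda>l. length l # l) L)) = (\<Sum>j<length L. Suc (length (L ! j)))"
  by (simp add: length_concat sum_list_sum_nth atLeast0LessThan)

lemma concat_blocks_nth:
  fixes L :: "nat list list"
  assumes "i < length L"
  defines "k \<equiv> \<Sum>j<i. Suc (length (L ! j))"
  shows "concat (map (\<lambda>l. length l # l) L) ! k = length (L ! i)"
    and "j < length (L ! i) \<Longrightarrow> concat (map (\<lambda>l. length l # l) L) ! (Suc (k + j)) = L ! i ! j"
proof -
  let ?c = "\<lambda>L. concat (map (\<lambda>l :: nat list. length l # l) L)"
  have k: "length (?c (take i L)) = k"
    using assms(1) unfolding length_concat_blocks k_def by simp
  have "?c L = ?c (take i L) @ (length (L ! i) # L ! i) @ ?c (drop (Suc i) L)"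
    using arg_cong[OF id_take_nth_drop[OF assms(1)], of ?c] by simp
  then have e: "?c L ! (k + j) = ((length (L ! i) # L ! i) @ ?c (drop (Suc i) L)) ! j" for j
    using k by (simp add: nth_append)
  show "?c L ! k = length (L ! i)" using e[of 0] by simp
  show "j < length (L ! i) \<Longrightarrow> ?c L ! (Suc (k + j)) = L ! i ! j"
    using e[of "Suc j"] by (simp add: nth_append)
qed

locale wf_lq_instance =
  fixes I :: lq_instance
  assumes wf: "wf_instance I"
begin

abbreviation (input) "enc \<equiv> encode_instance I"
abbreviation (input) "prefs \<equiv> pref_lists I"

lemma length_lists: "length prefs = n_agents I + n_resources I"
  using wf by (simp add: pref_lists_def wf_instance_def)

lemma encode_split:
  "enc = (n_agents I # n_resources I # lower_quota I) @ concat (map (\<lambda>l. length l # l) prefs)"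
  by (simp add: encode_instance_def pref_lists_def)

lemma length_quota: "length (lower_quota I) = n_resources I"
  using wf by (simp add: wf_instance_def)

lemma length_encode: "Suc (length enc) = list_start I (length prefs)"
  unfolding encode_split length_append length_concat_blocks
  by (simp add: length_quota list_start_def)

lemma length_encode_ge: "2 + n_resources I + n_agents I \<le> length enc"
proof -
  have "length prefs \<le> (\<Sum>j<length prefs. Suc (length (prefs ! j)))"
    using sum_mono[of "{..<length prefs}" "\<lambda>_. 1" "\<lambda>j. Suc (length (prefs ! j))"] by simp
  then show ?thesis using length_encode length_lists by (simp add: list_start_def)
qed

lemma encode_nth:
  "enc ! 0 = n_agents I" "enc ! 1 = n_resources I"
  "b < n_resources I \<Longrightarrow> enc ! (2 + b) = lower_quota I ! b"
  "i < length prefs \<Longrightarrow> enc ! (list_start I i - 1) = length (prefs ! i)"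
  "i < length prefs \<Longrightarrow> j < length (prefs ! i) \<Longrightarrow> enc ! (list_start I i + j) = prefs ! i ! j"
proof -
  show "enc ! 0 = n_agents I" "enc ! 1 = n_resources I" by (simp_all add: encode_split)
  show "b < n_resources I \<Longrightarrow> enc ! (2 + b) = lower_quota I ! b"
    by (simp add: encode_split nth_append length_quota)
  have e: "enc ! (2 + n_resources I + k) = concat (map (\<lambda>l. length l # l) prefs) ! k" for k
    using nth_append_length_plus[of "n_agents I # n_resources I # lower_quota I" _ k]
    unfolding encode_split by (simp add: length_quota)
  show "i < length prefs \<Longrightarrow> enc ! (list_start I i - 1) = length (prefs ! i)"
    using e[of "\<Sum>j<i. Suc (length (prefs ! j))"] concat_blocks_nth(1)[of i prefs]
    by (simp add: list_start_def)
  show "i < length prefs \<Longrightarrow> j < length (prefs ! i) \<Longrightarrow> enc ! (list_start I i + j) = prefs ! i ! j"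
    using e[of "Suc ((\<Sum>j<i. Suc (length (prefs ! j))) + j)"] concat_blocks_nth(2)[of i prefs j]
    by (simp add: list_start_def add_ac numeral_3_eq_3)
qed

section \<open>Parsing the preference lists\<close>

definition in_list :: "nat \<Rightarrow> nat \<Rightarrow> bool" where
  "in_list i p \<longleftrightarrow> i < length prefs \<and> list_start I i \<le> p \<and> p < list_start I i + length (prefs ! i)"

lemma in_list_unique: "in_list i p \<Longrightarrow> in_list i' p \<Longrightarrow> i = i'"
  using list_start_less[of i i' I] list_start_less[of i' i I] unfolding in_list_def by linarith

lemma in_list_less: "in_list i p \<Longrightarrow> p < length enc"
  using list_start_less[of i "length prefs" I] length_encode unfolding in_list_def by linarith

lemma input_word: "p < length enc \<Longrightarrow> input_store enc 0 p = enc ! p"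
  by (simp add: input_store_def)

text \<open>\<open>s 5 0\<close> lists have been begun and \<open>s 4 0\<close> entries of the last
  one are left, so the next length word is at \<open>j + s 4 0\<close> and its list starts one
  later. The equivalence for array 7 also forces 0 at length words.\<close>

definition parse_inv :: "nat \<Rightarrow> store \<Rightarrow> bool" where
  "parse_inv j s \<longleftrightarrow>
     (if j < 2 + n_resources I then s 5 0 = 0 \<and> s 4 0 = 0
      else s 5 0 \<le> length prefs \<and> j + s 4 0 + 1 = list_start I (s 5 0) \<and>
        (s 5 0 = 0 \<longrightarrow> s 4 0 = 0) \<and> (0 < s 5 0 \<longrightarrow> list_start I (s 5 0 - 1) \<le> j)) \<and>
     (\<forall>i < s 5 0. s 6 (Suc i) = list_start I i) \<and>
     (\<forall>p i. s 7 p = Suc i \<longleftrightarrow> p < j \<and> in_list i p)"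

lemma parse_inv_step:
  assumes inv: "parse_inv j s" and j: "j < length enc" "s 22 0 = j"
    and s: "s 0 = input_store enc 0" "s 3 0 = 2 + n_resources I"
  shows "parse_inv (Suc j) (sem parse_step s)"
proof -
  let ?c = "s 5 0" and ?r = "s 4 0" and ?L = "list_start I"
  have S6: "\<forall>i < ?c. s 6 (Suc i) = ?L i" and S7: "\<And>p i. s 7 p = Suc i \<longleftrightarrow> p < j \<and> in_list i p"
    using inv by (auto simp: parse_inv_def)
  show ?thesis
  proof (cases "j < 2 + n_resources I")
    case True
    have "\<not> in_list i j" for i using list_start_ge[of I i] True by (simp add: in_list_def)
    then have "s 7 p = Suc i \<longleftrightarrow> p < Suc j \<and> in_list i p" for p i
      using S7 by (auto simp: less_Suc_eq)
    moreover have "sem parse_step s = s" using True j s by (simp add: parse_step_def)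
    moreover have "?c = 0" "?r = 0" using True inv by (simp_all add: parse_inv_def)
    moreover have "Suc j = 2 + n_resources I \<longrightarrow> Suc (Suc j) = ?L 0"
      by (simp add: list_start_def)
    ultimately show ?thesis using True by (auto simp: parse_inv_def)
  next
    case False
    then have c: "?c \<le> length prefs" "j + ?r + 1 = ?L ?c" "?c = 0 \<longrightarrow> ?r = 0"
      "0 < ?c \<longrightarrow> ?L (?c - 1) \<le> j"
      using inv by (auto simp: parse_inv_def)
    show ?thesis
    proof (cases "?r = 0")
      case True
      have "?c \<noteq> length prefs" using c(2) True length_encode j(1) by auto
      then have cl: "?c < length prefs" using c(1) by simp
      have x: "s 0 j = length (prefs ! ?c)"
        using encode_nth(4)[OF cl] c(2) True s(1) j(1) input_word by (simp flip: c(2))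
      \<comment> \<open>A length word lies between lists: earlier lists end before \<open>j\<close>,
        later ones start after it.\<close>
      have "\<not> in_list i j" for i
      proof
        assume a: "in_list i j"
        show False
        proof (cases "i < ?c")
          case True
          then show False using list_start_less[OF True, of I] a c(2) \<open>?r = 0\<close> by (simp add: in_list_def)
        next
          case False
          then show False using list_start_mono[of ?c i I] a c(2) by (simp add: in_list_def)
        qed
      qed
      then have 7: "s 7 p = Suc i \<longleftrightarrow> p < Suc j \<and> in_list i p" for p i
        using S7 by (auto simp: less_Suc_eq)
      let ?s = "sem parse_step s"
      have e: "?s 5 0 = Suc ?c" "?s 4 0 = length (prefs ! ?c)" "?s 6 = (s 6)(Suc ?c := Suc j)" "?s 7 = s 7"
        using False True j s x by (simp_all add: parse_step_def)
      show ?thesis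
        unfolding parse_inv_def e using False 7 cl c(2) True S6
        by (auto simp: list_start_Suc less_Suc_eq)
    next
      case r: False
      then have c0: "0 < ?c" using c(3) by simp
      then obtain c' where c': "?c = Suc c'" by (cases ?c) auto
      have il: "in_list c' j"
        using c c' r list_start_Suc[of I c'] by (auto simp: in_list_def)
      let ?s = "sem parse_step s"
      have e: "?s 5 0 = ?c" "?s 4 0 = ?r - 1" "?s 6 = s 6" "?s 7 = (s 7)(j := ?c)"
        using False r j s by (simp_all add: parse_step_def)
      have "((s 7)(j := ?c)) p = Suc i \<longleftrightarrow> p < Suc j \<and> in_list i p" for p i
        using S7[of p i] il in_list_unique c' by (cases "p = j") auto
      then show ?thesis
        unfolding parse_inv_def e using False c r c' S6 by auto
    qed
  qed
qed

lemma parse_sem: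
  defines "s \<equiv> sem parse (input_store enc)"
  shows "s 2 0 = n_agents I"
    and "\<And>p i. s 7 p = Suc i \<longleftrightarrow> in_list i p"
    and "\<And>i. i < length prefs \<Longrightarrow> s 6 (Suc i) = list_start I i"
proof -
  define t where "t = sem (FAssign 3 (Num 0) (Plus (Num 2) (Cell 0 (Num 1))))
    (sem (FAssign 2 (Num 0) (Cell 0 (Num 0))) (input_store enc))"
  have st: "s = sem (For 22 1 parse_step) t" by (simp add: s_def parse_def t_def)
  have len: "2 \<le> length enc" using length_encode_ge by simp
  then have t: "t 0 = input_store enc 0" "t 1 0 = length enc" "t 2 0 = n_agents I"
    "t 3 0 = 2 + n_resources I" "t 4 0 = 0" "t 5 0 = 0" "t 7 p = 0" for p
    using encode_nth(1,2) by (auto simp: t_def input_store_def)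
  have "parse_inv (t 1 0) s"
    unfolding st
  proof (rule For_invariant[where Inv = parse_inv])
    show "22 \<notin> writes parse_step" by (simp add: parse_step_def)
    show "parse_inv 0 (set_counter 22 0 t)" using t by (simp add: parse_inv_def)
    fix j s' assume j: "j < t 1 0" "s' 22 0 = j"
      and fr: "\<And>x. x \<notin> writes (For 22 1 parse_step) \<Longrightarrow> s' x = t x" and inv: "parse_inv j s'"
    have "s' 0 = input_store enc 0" "s' 3 0 = 2 + n_resources I"
      using t fr by (simp_all add: parse_step_def)
    then have "parse_inv (Suc j) (sem parse_step s')"
      using parse_inv_step[OF inv] j t by simp
    then show "parse_inv (Suc j) (set_counter 22 (Suc j) (sem parse_step s'))"
      by (auto simp: parse_inv_def split: if_splits)
  qed
  then have inv: "parse_inv (length enc) s" using t by simp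
  have "\<not> length enc < 2 + n_resources I" using length_encode_ge by simp
  then have c: "s 5 0 \<le> length prefs" "length enc + s 4 0 + 1 = list_start I (s 5 0)"
    using inv by (auto simp: parse_inv_def)
  \<comment> \<open>A list still to begin would start at most at the input length, but the invariant
    puts the next start beyond it.\<close>
  have "s 5 0 = length prefs"
  proof (rule ccontr)
    assume "s 5 0 \<noteq> length prefs"
    then have "s 5 0 < length prefs" using c(1) by simp
    from list_start_less[OF this, of I] show False using c(2) length_encode by simp
  qed
  then show "\<And>i. i < length prefs \<Longrightarrow> s 6 (Suc i) = list_start I i"
    using inv by (simp add: parse_inv_def)
  show "\<And>p i. s 7 p = Suc i \<longleftrightarrow> in_list i p"
    using inv in_list_less by (auto simp: parse_inv_def)
  show "s 2 0 = n_agents I"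
    unfolding st using t by (subst sem_frame) (auto simp: parse_step_def)
qed

end

section \<open>Linking the two occurrences of each edge\<close>

definition twin :: "store \<Rightarrow> nat \<Rightarrow> nat \<Rightarrow> bool" where
  "twin s p r \<longleftrightarrow> 0 < s 7 p \<and> s 7 p \<le> s 2 0 \<and> s 7 r = s 2 0 + 1 + s 0 p \<and> s 7 p = s 0 r + 1"

lemma rank_sem:
  assumes "\<And>p. s 8 p = 0" and r0: "s 7 0 = 0"
  defines "s' \<equiv> sem rank s"
  shows "0 < s' 8 p \<Longrightarrow> p < s 1 0 \<and> s' 8 p < s 1 0 \<and> twin s p (s' 8 p)"
    and "p < s 1 0 \<Longrightarrow> r < s 1 0 \<Longrightarrow> twin s p r \<Longrightarrow> 0 < s' 8 p"
proof -
  let ?ok = "\<lambda>s'. \<forall>p. 0 < s' 8 p \<longrightarrow> p < s 1 0 \<and> s' 8 p < s 1 0 \<and> twin s p (s' 8 p)"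
  let ?all = "\<lambda>j s'. \<forall>p<j. (\<exists>r < s 1 0. twin s p r) \<longrightarrow> 0 < s' 8 p"
  \<comment> \<open>Position 0 is in no list, so a stored twin is never 0 and 0 can mean that there
    is none.\<close>
  have tw: "0 < r" if "twin s p r" for p r
    using that r0 by (cases r) (auto simp: twin_def)
  have "?ok s' \<and> ?all (s 1 0) s'"
    unfolding s'_def rank_def
  proof (rule For_invariant[where Inv = "\<lambda>j s'. ?ok s' \<and> ?all j s'"])
    show "22 \<notin> writes (For 23 1 rank_step)" by (simp add: rank_step_def)
    show "?ok (set_counter 22 0 s) \<and> ?all 0 (set_counter 22 0 s)" using assms(1) by simp
    fix j t assume j: "j < s 1 0" "t 22 0 = j"
      and fr: "\<And>x. x \<notin> writes (For 22 1 (For 23 1 rank_step)) \<Longrightarrow> t x = s x"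
      and inv: "?ok t \<and> ?all j t"
    have fr': "t x = s x" if "x \<notin> {8, 22, 23}" for x
      using that by (intro fr) (auto simp: rank_step_def)
    let ?Inv = "\<lambda>k t. ?ok t \<and> ?all j t \<and> ((\<exists>r<k. twin s j r) \<longrightarrow> 0 < t 8 j)"
    have "?Inv (t 1 0) (sem (For 23 1 rank_step) t)"
    proof (rule For_invariant[where Inv = ?Inv])
      show "23 \<notin> writes rank_step" by (simp add: rank_step_def)
      show "?Inv 0 (set_counter 23 0 t)" using inv by simp
      fix k u assume k: "k < t 1 0" "u 23 0 = k"
        and fru: "\<And>x. x \<notin> writes (For 23 1 rank_step) \<Longrightarrow> u x = t x"
        and invu: "?Inv k u"
      have u: "u x = t x" if "x \<notin> {8, 23}" for x
        using that by (intro fru) (auto simp: rank_step_def)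
      have us: "u x = s x" if "x \<notin> {8, 22, 23}" for x
        using that u fr' by simp
      have e: "sem rank_step u 8 = (if twin s j k then (u 8)(j := k) else u 8)"
        using j k u us by (simp add: rank_step_def twin_def)
      have kn: "k < s 1 0" using k fr' by simp
      show "?Inv (Suc k) (set_counter 23 (Suc k) (sem rank_step u))"
      proof (cases "twin s j k")
        case True
        then show ?thesis using invu j(1) kn tw[OF True] by (simp add: e)
      next
        case False
        then show ?thesis using invu by (simp add: e less_Suc_eq) blast
      qed
    qed
    then show "?ok (set_counter 22 (Suc j) (sem (For 23 1 rank_step) t)) \<and>
        ?all (Suc j) (set_counter 22 (Suc j) (sem (For 23 1 rank_step) t))"
      using fr' by (simp add: less_Suc_eq)
  qed
  then show "0 < s' 8 p \<Longrightarrow> p < s 1 0 \<and> s' 8 p < s 1 0 \<and> twin s p (s' 8 p)"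
    and "p < s 1 0 \<Longrightarrow> r < s 1 0 \<Longrightarrow> twin s p r \<Longrightarrow> 0 < s' 8 p"
    by blast+
qed

lemma prefers_nth:
  assumes "distinct l" "i < length l" "j < length l"
  shows "prefers l (l ! i) (Some (l ! j)) \<longleftrightarrow> i < j"
  using assms by (auto simp: prefers_def nth_eq_iff_index_eq)

context wf_lq_instance
begin

definition indexed :: store where
  "indexed = sem rank (sem parse (input_store enc))"

lemma indexed_frame: "x \<notin> {2, 3, 4, 5, 6, 7, 8, 22, 23} \<Longrightarrow> indexed x = input_store enc x"
  unfolding indexed_def
  by (subst sem_frame, simp add: rank_def rank_step_def)
    (subst sem_frame; auto simp: parse_def parse_step_def)

lemma rank_frame: "x \<notin> {8, 22, 23} \<Longrightarrow> indexed x = sem parse (input_store enc) x"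
  unfolding indexed_def by (rule sem_frame) (simp add: rank_def rank_step_def)

lemma indexed_words: "p < length enc \<Longrightarrow> indexed 0 p = enc ! p"
  by (simp add: indexed_frame input_word)

lemma indexed_length: "indexed 1 0 = length enc"
  by (simp add: indexed_frame input_store_def)

lemma indexed_own: "indexed 7 p = Suc i \<longleftrightarrow> in_list i p"
  using parse_sem(2) by (simp add: rank_frame)

lemma indexed_start: "i < n_agents I + n_resources I \<Longrightarrow> indexed 6 (Suc i) = list_start I i"
  using parse_sem(3) length_lists by (simp add: rank_frame)

lemma indexed_agents: "indexed 2 0 = n_agents I"
  using parse_sem(1) by (simp add: rank_frame)

lemma agent_list: "a < n_agents I \<Longrightarrow> pref_lists I ! a = agent_pref I ! a"
  using wf by (simp add: pref_lists_def wf_instance_def nth_append)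

lemma resource_list: "b < n_resources I \<Longrightarrow> pref_lists I ! (n_agents I + b) = resource_pref I ! b"
  using wf by (simp add: pref_lists_def wf_instance_def nth_append)

lemma in_list_word:
  assumes "in_list i p"
  obtains j where "j < length (pref_lists I ! i)" "p = list_start I i + j" "indexed 0 p = pref_lists I ! i ! j"
proof -
  define j where "j = p - list_start I i"
  have j: "j < length (pref_lists I ! i)" "p = list_start I i + j" "i < length (pref_lists I)"
    using assms by (auto simp: in_list_def j_def)
  moreover have "indexed 0 p = pref_lists I ! i ! j"
    using indexed_words[of p] in_list_less[OF assms] encode_nth(5)[OF j(3,1)] j(2) by simp
  ultimately show thesis using that by blast
qed

lemma indexed_twin: "twin (sem parse (input_store enc)) p r \<longleftrightarrow>
    0 < indexed 7 p \<and> indexed 7 p \<le> n_agents I \<and>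
    indexed 7 r = Suc (n_agents I + indexed 0 p) \<and> indexed 7 p = Suc (indexed 0 r)"
  unfolding twin_def by (simp flip: rank_frame indexed_agents)

lemma indexed_rank:
  shows "0 < indexed 8 p \<Longrightarrow> p < length enc \<and> indexed 8 p < length enc \<and>
      twin (sem parse (input_store enc)) p (indexed 8 p)"
    and "p < length enc \<Longrightarrow> r < length enc \<Longrightarrow> twin (sem parse (input_store enc)) p r \<Longrightarrow> 0 < indexed 8 p"
proof -
  let ?s = "sem parse (input_store enc)"
  have 8: "?s 8 p = 0" for p
    by (subst sem_frame) (auto simp: parse_def parse_step_def input_store_def)
  have 1: "?s 1 0 = length enc"
    using indexed_length by (simp add: rank_frame)
  have "?s 7 0 = 0"
  proof (cases "?s 7 0")
    case (Suc i)
    then have "in_list i 0" using parse_sem(2) by simp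
    then show ?thesis using list_start_ge[of I i] by (simp add: in_list_def)
  qed
  from rank_sem[of ?s, OF 8 this, folded indexed_def, unfolded 1]
  show "0 < indexed 8 p \<Longrightarrow> p < length enc \<and> indexed 8 p < length enc \<and>
      twin (sem parse (input_store enc)) p (indexed 8 p)"
    and "p < length enc \<Longrightarrow> r < length enc \<Longrightarrow> twin (sem parse (input_store enc)) p r \<Longrightarrow> 0 < indexed 8 p"
    by blast+
qed

lemma agent_prefs: "a < n_agents I \<Longrightarrow> distinct (agent_pref I ! a) \<and> set (agent_pref I ! a) \<subseteq> {..<n_resources I}"
  using wf by (simp add: wf_instance_def)

lemma resource_prefs: "b < n_resources I \<Longrightarrow> distinct (resource_pref I ! b)"
  using wf by (simp add: wf_instance_def)

text \<open>Serves to translate the orders on positions and on ranks into those of the list indices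
  \<open>i\<close> and \<open>j\<close>, where \<open>prefers_nth\<close> applies.\<close>

definition at_index :: "nat \<Rightarrow> nat \<Rightarrow> nat \<Rightarrow> nat \<Rightarrow> bool" where
  "at_index p a i j \<longleftrightarrow> a < n_agents I \<and> i < length (agent_pref I ! a) \<and> p = list_start I a + i \<and>
     indexed 7 p = Suc a \<and> indexed 0 p = agent_pref I ! a ! i \<and> indexed 0 p < n_resources I \<and>
     j < length (resource_pref I ! indexed 0 p) \<and> resource_pref I ! indexed 0 p ! j = a \<and>
     indexed 8 p = list_start I (n_agents I + indexed 0 p) + j"

lemma pos_at_index:
  assumes "0 < indexed 8 p"
  shows "\<exists>a i j. at_index p a i j"
proof -
  let ?r = "indexed 8 p"
  from indexed_rank(1)[OF assms] have t: "0 < indexed 7 p" "indexed 7 p \<le> n_agents I"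
    "indexed 7 ?r = Suc (n_agents I + indexed 0 p)" "indexed 7 p = Suc (indexed 0 ?r)"
    by (auto simp: indexed_twin)
  define a where "a = indexed 0 ?r"
  have a: "a < n_agents I" "in_list a p" using t by (auto simp: a_def indexed_own[symmetric])
  from in_list_word[OF a(2)] obtain i where i: "i < length (pref_lists I ! a)"
    "p = list_start I a + i" "indexed 0 p = pref_lists I ! a ! i" .
  have b: "indexed 0 p < n_resources I"
    using i agent_list[OF a(1)] agent_prefs[OF a(1)] by (metis lessThan_iff nth_mem subsetD)
  from t(3) have "in_list (n_agents I + indexed 0 p) ?r" by (simp add: indexed_own)
  from in_list_word[OF this] obtain j where j: "j < length (pref_lists I ! (n_agents I + indexed 0 p))"
    "?r = list_start I (n_agents I + indexed 0 p) + j"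
    "indexed 0 ?r = pref_lists I ! (n_agents I + indexed 0 p) ! j" .
  have "at_index p a i j"
    unfolding at_index_def
  proof (intro conjI)
    show "a < n_agents I" "p = list_start I a + i" "indexed 0 p < n_resources I"
      "indexed 8 p = list_start I (n_agents I + indexed 0 p) + j" by fact+
    show "i < length (agent_pref I ! a)" "indexed 0 p = agent_pref I ! a ! i"
      using i(1,3) unfolding agent_list[OF a(1)] by simp_all
    show "indexed 7 p = Suc a" using t(4) unfolding a_def .
    show "j < length (resource_pref I ! indexed 0 p)" "resource_pref I ! indexed 0 p ! j = a"
      using j(1,3) unfolding resource_list[OF b] a_def by simp_all
  qed
  then show ?thesis by blast
qed

text \<open>Well-formedness makes adjacency symmetric: the resource lists the agent too, so the
  search for a twin succeeds.\<close>

lemma index_pos: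
  assumes a: "a < n_agents I" and i: "i < length (agent_pref I ! a)"
  defines "p \<equiv> list_start I a + i"
  shows "0 < indexed 8 p" "indexed 7 p = Suc a" "indexed 0 p = agent_pref I ! a ! i"
proof -
  have al: "a < length (pref_lists I)" using a length_lists by simp
  have il: "in_list a p" using i agent_list[OF a] al by (simp add: in_list_def p_def)
  then show 7: "indexed 7 p = Suc a" by (simp add: indexed_own)
  show 0: "indexed 0 p = agent_pref I ! a ! i"
    using indexed_words[of p] in_list_less[OF il] encode_nth(5)[OF al, of i] i agent_list[OF a]
    by (simp add: p_def)
  let ?b = "indexed 0 p"
  have bs: "?b \<in> set (agent_pref I ! a)" using 0 i by simp
  then have b: "?b < n_resources I" using agent_prefs[OF a] by auto
  have "a \<in> set (resource_pref I ! ?b)" using wf a b bs by (simp add: wf_instance_def)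
  then obtain j where j: "j < length (resource_pref I ! ?b)" "resource_pref I ! ?b ! j = a"
    by (auto simp: in_set_conv_nth)
  define r where "r = list_start I (n_agents I + ?b) + j"
  have bl: "n_agents I + ?b < length (pref_lists I)" using b length_lists by simp
  have ir: "in_list (n_agents I + ?b) r"
    using j bl resource_list[OF b] by (simp add: in_list_def r_def)
  have "indexed 0 r = a"
    using indexed_words[of r] in_list_less[OF ir] encode_nth(5)[OF bl, of j] j resource_list[OF b]
    by (simp add: r_def)
  moreover have "indexed 7 r = Suc (n_agents I + ?b)" using ir by (simp add: indexed_own)
  ultimately have "twin (sem parse (input_store enc)) p r" using 7 a by (simp add: indexed_twin)
  then show "0 < indexed 8 p"
    using indexed_rank(2) in_list_less[OF il] in_list_less[OF ir] by blast
qed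

lemma edge_positions_indexed:
  "edge_positions I (\<lambda>p. 0 < indexed 8 p) (indexed 7) (indexed 0) (indexed 8) (indexed 6)"
proof
  let ?pos = "\<lambda>p. 0 < indexed 8 p"
  have uniq: "p = p'" if "?pos p" "?pos p'" "indexed 7 p = indexed 7 p'" "indexed 0 p = indexed 0 p'" for p p'
  proof -
    from pos_at_index[OF that(1)] pos_at_index[OF that(2)] obtain a i j a' i' j'
      where "at_index p a i j" "at_index p' a' i' j'" by blast
    then show ?thesis
      using that(3,4) agent_prefs[of a] nth_eq_iff_index_eq[of "agent_pref I ! a" i i']
      by (auto simp: at_index_def)
  qed
  \<comment> \<open>The word at \<open>indexed 8 p\<close> names the agent, so equal ranks force
    equal owners; this gives \<open>rnk_inj\<close>.\<close>
  have own: "indexed 7 p = Suc (indexed 0 (indexed 8 p))" if "?pos p" for p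
    using indexed_rank(1)[OF that] by (simp add: indexed_twin)
  have "{p. ?pos p} \<subseteq> {..<length enc}" using indexed_rank(1) by blast
  then show "finite {p. ?pos p}" by (rule finite_subset) simp
  show "0 < indexed 7 p \<and> (indexed 7 p - 1, indexed 0 p) \<in> edges I" if "?pos p" for p
    using pos_at_index[OF that] by (auto simp: at_index_def edges_def)
  show "\<exists>p. ?pos p \<and> indexed 7 p = Suc a \<and> indexed 0 p = b" if "(a, b) \<in> edges I" for a b
    using that index_pos unfolding edges_def by (auto simp: in_set_conv_nth) blast
  show "prefers (agent_pref I ! (indexed 7 p - 1)) (indexed 0 p) (Some (indexed 0 p')) \<longleftrightarrow> p < p'"
    if pp: "?pos p" "?pos p'" "indexed 7 p = indexed 7 p'" for p p'
  proof -
    from pos_at_index[OF pp(1)] pos_at_index[OF pp(2)] obtain a i j a' i' j'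
      where x: "at_index p a i j" "at_index p' a' i' j'" by blast
    then have "a' = a" using pp(3) by (simp add: at_index_def)
    then show ?thesis
      using x agent_prefs[of a] prefers_nth[of "agent_pref I ! a" i i'] by (auto simp: at_index_def)
  qed
  show "prefers (resource_pref I ! indexed 0 p) (indexed 7 p - 1) (Some (indexed 7 p' - 1)) \<longleftrightarrow>
      indexed 8 p < indexed 8 p'"
    if pp: "?pos p" "?pos p'" "indexed 0 p = indexed 0 p'" for p p'
  proof -
    from pos_at_index[OF pp(1)] pos_at_index[OF pp(2)] obtain a i j a' i' j'
      where x: "at_index p a i j" "at_index p' a' i' j'" by blast
    then show ?thesis
      using pp(3) resource_prefs[of "indexed 0 p"] prefers_nth[of "resource_pref I ! indexed 0 p" j j']
      by (auto simp: at_index_def)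
  qed
  show "p = p'" if "?pos p" "?pos p'" "indexed 7 p = indexed 7 p'" "indexed 0 p = indexed 0 p'" for p p'
    using uniq that by blast
  show "p = p'" if "?pos p" "?pos p'" "indexed 0 p = indexed 0 p'" "indexed 8 p = indexed 8 p'" for p p'
    using uniq that own by metis
  show "?pos p' \<and> indexed 7 p' = indexed 7 p"
    if pp: "?pos p" "indexed 6 (indexed 7 p) \<le> p'" "p' \<le> p" for p p'
  proof -
    from pos_at_index[OF pp(1)] obtain a i j where x: "at_index p a i j" by blast
    then have "indexed 6 (Suc a) = list_start I a" by (intro indexed_start) (simp add: at_index_def)
    then show ?thesis
      using index_pos[of a "p' - list_start I a"] x pp by (auto simp: at_index_def)
  qed
  show "indexed 6 (indexed 7 p) \<le> p" if "?pos p" for p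
  proof -
    from pos_at_index[OF that] obtain a i j where x: "at_index p a i j" by blast
    then have "indexed 6 (Suc a) = list_start I a" by (intro indexed_start) (simp add: at_index_def)
    moreover have "indexed 7 p = Suc a" "list_start I a \<le> p" using x unfolding at_index_def by auto
    ultimately show ?thesis by simp
  qed
  show "wf_instance I" by (rule wf)
qed

lemma loaded_instance_indexed:
  "loaded_instance I (indexed 7) (indexed 0) (indexed 8) (indexed 6) (length enc)"
proof (intro loaded_instance.intro[OF edge_positions_indexed] loaded_instance_axioms.intro)
  note len = length_encode_ge
  note iw = indexed_words and en = encode_nth
  show "0 < length enc" using len by linarith
  show "0 < p \<and> p < length enc" if "0 < indexed 8 p" for p
    using pos_at_index[OF that] indexed_rank(1)[OF that] list_start_ge[of I]
    by (auto simp: at_index_def) (metis add_is_0 le_zero_eq not_gr_zero numeral_neq_zero)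
  show "indexed 7 p < length enc" if "0 < indexed 8 p" for p
    using pos_at_index[OF that] len by (auto simp: at_index_def)
  have 1: "indexed 0 1 = n_resources I" using iw[of 1] en(2) len by simp
  have 2: "indexed 0 (2 + b) = lower_quota I ! b" if "b < n_resources I" for b
    using iw[of "2 + b"] en(3)[OF that] len that by simp
  show "b < indexed 0 1 \<and> indexed 0 (2 + b) = 1 \<longleftrightarrow> b \<in> lq_resources I" for b
    using 1 2 by (auto simp: lq_resources_def)
  show "indexed 0 (2 + indexed 0 p) = 1 \<longleftrightarrow> indexed 0 p \<in> lq_resources I" if "0 < indexed 8 p" for p
  proof -
    have "indexed 0 p < n_resources I" using pos_at_index[OF that] by (auto simp: at_index_def)
    then show ?thesis using 2[of "indexed 0 p"] by (simp add: lq_resources_def)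
  qed
  show "b < length enc" if "b \<in> lq_resources I" for b
    using that len by (simp add: lq_resources_def)
qed

end

section \<open>Fixed-parameter tractability\<close>

context loaded_instance
begin

section \<open>The number of guesses and its bounds\<close>

lemma weigh_sem:
  assumes "s 0 = res" "s 1 0 = n" "s 8 = rnk"
  shows "sem weigh s 9 0 = 2 ^ length (lq_from 0)"
    and "\<And>p. lq_pos p \<Longrightarrow> sem weigh s 10 p = 2 ^ length (lq_from (Suc p))"
proof -
  \<comment> \<open>The scan runs downwards: after \<open>j\<close> rounds the positions from
    \<open>n - j\<close> on have been treated.\<close>
  let ?Inv = "\<lambda>j s'. s' 9 0 = 2 ^ length (lq_from (n - j)) \<and>
    (\<forall>p. lq_pos p \<and> n - j \<le> p \<longrightarrow> s' 10 p = 2 ^ length (lq_from (Suc p)))"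
  define t where "t = s(9 := (s 9)(0 := 1))"
  have t: "t 0 = res" "t 1 0 = n" "t 8 = rnk" "t 9 0 = 1" using assms by (simp_all add: t_def)
  have "?Inv (t 1 0) (sem (For 22 1 weigh_step) t)"
  proof (rule For_invariant[where Inv = ?Inv])
    show "22 \<notin> writes weigh_step" by (simp add: weigh_step_def)
    have "\<not> (lq_pos p \<and> n \<le> p)" for p using pos_bounds[of p] by (auto simp: lq_pos_def)
    then show "?Inv 0 (set_counter 22 0 t)" using t by auto
    fix j s' assume j: "j < t 1 0" "s' 22 0 = j"
      and fr: "\<And>x. x \<notin> writes (For 22 1 weigh_step) \<Longrightarrow> s' x = t x" and inv: "?Inv j s'"
    have s': "s' 0 = res" "s' 1 0 = n" "s' 8 = rnk" using t fr by (simp_all add: weigh_step_def)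
    define q where "q = n - 1 - j"
    have q: "q < n" "n - j = Suc q" "n - Suc j = q" using j t by (simp_all add: q_def)
    have b: "bval (lq_at (Minus (Minus (Var 1) (Num 1)) (Var 22))) s' \<longleftrightarrow> lq_pos q"
      using s' j by (simp add: lq_at_def lq_pos_iff q_def)
    have e: "sem weigh_step s' 9 0 = (if lq_pos q then s' 9 0 + s' 9 0 else s' 9 0)"
      "sem weigh_step s' 10 = (if lq_pos q then (s' 10)(q := s' 9 0) else s' 10)"
      using b s' j by (simp_all add: weigh_step_def q_def)
    have "sem weigh_step s' 9 0 = 2 ^ length (lq_from q)"
      using inv q unfolding e by (simp add: lq_from_step)
    moreover have "sem weigh_step s' 10 p = 2 ^ length (lq_from (Suc p))" if "lq_pos p" "q \<le> p" for p
      using inv q that unfolding e by (cases "p = q") auto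
    ultimately show "?Inv (Suc j) (set_counter 22 (Suc j) (sem weigh_step s'))"
      using q by simp
  qed
  moreover have "sem weigh s = sem (For 22 1 weigh_step) t" by (simp add: weigh_def t_def)
  ultimately show "sem weigh s 9 0 = 2 ^ length (lq_from 0)"
    and "\<And>p. lq_pos p \<Longrightarrow> sem weigh s 10 p = 2 ^ length (lq_from (Suc p))"
    using t by simp_all
qed

lemma count_resources_sem:
  assumes "s 0 = res" "s 1 0 = n" "s 11 0 = 0"
  shows "sem count_resources s 11 0 = num_lq I"
proof -
  have S: "{b. b < Suc j \<and> b \<in> lq_resources I} = (if j \<in> lq_resources I
    then insert j {b. b < j \<and> b \<in> lq_resources I} else {b. b < j \<and> b \<in> lq_resources I})" for j
    by (auto simp: less_Suc_eq)
  let ?Inv = "\<lambda>j s'. s' 11 0 = card {b. b < j \<and> b \<in> lq_resources I}"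
  let ?c = "FCond (lq_resource_at (Var 22)) (FAssign 11 (Num 0) (Plus (Var 11) (Num 1))) FSkip"
  have "?Inv (s 1 0) (sem count_resources s)"
    unfolding count_resources_def
  proof (rule For_invariant[where Inv = ?Inv])
    fix j s' assume j: "j < s 1 0" "s' 22 0 = j"
      and fr: "\<And>x. x \<notin> writes (For 22 1 ?c) \<Longrightarrow> s' x = s x" and inv: "?Inv j s'"
    have "s' 0 = res" using fr assms by simp
    then have "bval (lq_resource_at (Var 22)) s' \<longleftrightarrow> j \<in> lq_resources I"
      using j lq_iff[of j] by (simp add: lq_resource_at_def)
    then show "?Inv (Suc j) (set_counter 22 (Suc j) (sem ?c s'))"
      using inv by (simp add: S)
  qed (use assms in simp_all)
  moreover have "{b. b < n \<and> b \<in> lq_resources I} = lq_resources I" using lq_less by auto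
  ultimately show ?thesis using assms by (simp add: num_lq_def)
qed

lemma lq_agents_eq: "lq_agents I = (\<lambda>i. i - 1) ` own ` {p. lq_pos p}"
proof
  show "lq_agents I \<subseteq> (\<lambda>i. i - 1) ` own ` {p. lq_pos p}"
  proof
    fix a assume "a \<in> lq_agents I"
    then obtain b where b: "b \<in> lq_resources I" "(a, b) \<in> edges I" by (auto simp: lq_agents_def)
    from edge_pos[OF b(2)] obtain p where "0 < rnk p" "own p = Suc a" "res p = b" by blast
    with b show "a \<in> (\<lambda>i. i - 1) ` own ` {p. lq_pos p}" by (force simp: lq_pos_def)
  qed
  show "(\<lambda>i. i - 1) ` own ` {p. lq_pos p} \<subseteq> lq_agents I"
  proof clarify
    fix p assume "lq_pos p"
    then have "res p \<in> lq_resources I" "(own p - 1, res p) \<in> edges I"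
      using pos_edge by (auto simp: lq_pos_def)
    then show "own p - 1 \<in> lq_agents I" by (auto simp: lq_agents_def)
  qed
qed

lemma count_agents_sem:
  assumes "s 0 = res" "s 1 0 = n" "s 7 = own" "s 8 = rnk" "s 12 0 = 0" "\<And>i. s 13 i = 0"
  shows "sem count_agents s 12 0 = card (lq_agents I)"
proof -
  let ?A = "\<lambda>j. own ` {p. p < j \<and> lq_pos p}"
  let ?Inv = "\<lambda>j s'. s' 12 0 = card (?A j) \<and> (\<forall>i. s' 13 i = 0 \<longleftrightarrow> i \<notin> ?A j)"
  let ?c = "FCond (Conj (lq_at (Var 22)) (Eq (Cell 13 (Cell 7 (Var 22))) (Num 0)))
       (FSeq (FAssign 13 (Cell 7 (Var 22)) (Num 1))
             (FAssign 12 (Num 0) (Plus (Var 12) (Num 1)))) FSkip"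
  have S: "?A (Suc j) = (if lq_pos j then insert (own j) (?A j) else ?A j)" for j
    by (auto simp: less_Suc_eq)
  have "?Inv (s 1 0) (sem count_agents s)"
    unfolding count_agents_def
  proof (rule For_invariant[where Inv = ?Inv])
    fix j s' assume j: "j < s 1 0" "s' 22 0 = j"
      and fr: "\<And>x. x \<notin> writes (For 22 1 ?c) \<Longrightarrow> s' x = s x" and inv: "?Inv j s'"
    have s': "s' 0 = res" "s' 7 = own" "s' 8 = rnk" using fr assms by simp_all
    have "bval (lq_at (Var 22)) s' \<longleftrightarrow> lq_pos j"
      using j s' by (simp add: lq_at_def lq_pos_iff)
    moreover have "s' 13 (own j) = 0 \<longleftrightarrow> own j \<notin> ?A j" using inv by blast
    ultimately have e: "sem ?c s' 12 0 = (if lq_pos j \<and> own j \<notin> ?A j then Suc (s' 12 0) else s' 12 0)"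
      "sem ?c s' 13 = (if lq_pos j \<and> own j \<notin> ?A j then (s' 13)(own j := 1) else s' 13)"
      using j s' by simp_all
    have fin: "finite (?A j)" by simp
    have "sem ?c s' 12 0 = card (?A (Suc j))"
      using inv card_insert_if[OF fin, of "own j"] unfolding e S by simp
    moreover have "sem ?c s' 13 i = 0 \<longleftrightarrow> i \<notin> ?A (Suc j)" for i
      using inv unfolding e S by (cases "i = own j") auto
    ultimately show "?Inv (Suc j) (set_counter 22 (Suc j) (sem ?c s'))"
      by (simp del: sem.simps)
  qed (use assms in simp_all)
  moreover have "{p. p < n \<and> lq_pos p} = {p. lq_pos p}" using pos_bounds by (auto simp: lq_pos_def)
  ultimately have "sem count_agents s 12 0 = card (own ` {p. lq_pos p})" using assms by simp
  \<comment> \<open>The program counts list numbers. These are positive, so passing from them to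
    agents by subtracting one is injective.\<close>
  also have "\<dots> = card (lq_agents I)"
    unfolding lq_agents_eq
    by (rule card_image[symmetric])
      (use pos_Suc in \<open>auto simp: inj_on_def lq_pos_def, metis\<close>)
  finally show ?thesis .
qed

lemma length_lq_from: "length (lq_from 0) = card {p. lq_pos p}"
proof -
  have "{p. lq_pos p} = set (lq_from 0)"
    using pos_bounds by (auto simp: lq_from_def lq_pos_def)
  then show ?thesis using distinct_card[of "lq_from 0"] by (simp add: lq_from_def)
qed

lemma finite_lq: "finite (lq_resources I)"
  by (simp add: lq_resources_def)

lemma finite_lq_agents: "finite (lq_agents I)"
  by (rule finite_subset[of _ "{..<n_agents I}"]) (auto simp: lq_agents_def edges_def)

lemma inj_res_own: "inj_on (\<lambda>p. (res p, own p - 1)) {p. lq_pos p}"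
  using inj_pos by (auto simp: inj_on_def lq_pos_def)

lemma length_lq_from_le_lists: "length (lq_from 0) \<le> num_lq I * max_lq_list I"
proof -
  let ?S = "SIGMA b : lq_resources I. set (resource_pref I ! b)"
  have "card {p. lq_pos p} \<le> card ?S"
  proof (rule card_inj_on_le[OF inj_res_own])
    show "(\<lambda>p. (res p, own p - 1)) ` {p. lq_pos p} \<subseteq> ?S"
    proof clarsimp
      fix p assume p: "lq_pos p"
      then have "(own p - 1, res p) \<in> edges I" using pos_edge by (auto simp: lq_pos_def)
      then show "res p \<in> lq_resources I \<and> own p - Suc 0 \<in> set (resource_pref I ! res p)"
        using p wf by (auto simp: lq_pos_def edges_def wf_instance_def)
    qed
    show "finite ?S" using finite_lq by simp
  qed
  also have "\<dots> = (\<Sum>b \<in> lq_resources I. card (set (resource_pref I ! b)))"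
    using finite_lq by simp
  also have "\<dots> \<le> (\<Sum>b \<in> lq_resources I. max_lq_list I)"
  proof (rule sum_mono)
    fix b assume "b \<in> lq_resources I"
    then have "length (resource_pref I ! b) \<le> max_lq_list I"
      unfolding max_lq_list_def using finite_lq by (intro Max_ge) auto
    then show "card (set (resource_pref I ! b)) \<le> max_lq_list I"
      using card_length order.trans by blast
  qed
  finally show ?thesis by (simp add: length_lq_from num_lq_def)
qed

lemma length_lq_from_le_agents: "length (lq_from 0) \<le> num_lq I * card (lq_agents I)"
proof -
  have "card {p. lq_pos p} \<le> card (lq_resources I \<times> lq_agents I)"
  proof (rule card_inj_on_le[OF inj_res_own])
    show "(\<lambda>p. (res p, own p - 1)) ` {p. lq_pos p} \<subseteq> lq_resources I \<times> lq_agents I"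
      unfolding lq_agents_eq by (auto simp: lq_pos_def)
    show "finite (lq_resources I \<times> lq_agents I)" using finite_lq finite_lq_agents by simp
  qed
  then show ?thesis by (simp add: length_lq_from num_lq_def card_cartesian_product)
qed

text \<open>Partners of distinct LQ resources are distinct agents: the pigeonhole behind the test at
  the end of \<open>prepare\<close>.\<close>

lemma solution_num_lq:
  assumes "solution m I M"
  shows "num_lq I \<le> card (lq_agents I)"
proof -
  note M = solution_matching[OF assms]
  have "\<exists>a. (a, b) \<in> M" if "b \<in> lq_resources I" for b
  proof -
    from that solution_feasible[OF assms] obtain a where "resource_partner M b = Some a"
      by (auto simp: feasible_def)
    then show ?thesis using resource_partner_SomeD[OF M] by blast
  qed
  then obtain h where h: "\<And>b. b \<in> lq_resources I \<Longrightarrow> (h b, b) \<in> M" by metis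
  have "inj_on h (lq_resources I)"
    using h M unfolding matching_def by (intro inj_onI) metis
  moreover have "h ` lq_resources I \<subseteq> lq_agents I"
    using h M unfolding matching_def lq_agents_def by blast
  ultimately show ?thesis
    unfolding num_lq_def using card_inj_on_le finite_lq_agents by blast
qed

end

section \<open>Running time and correctness of the solver\<close>

lemma bounds_programs:
  "bounds prepare = {1}" "bounds (try_guess m) = {1}" "bounds write_result = {1}"
  "bounds write_length = {}"
  by (auto simp: prepare_def write_result_def write_length_def step_defs)

lemma writes_programs:
  "writes prepare = {2, 3, 4, 5, 6, 7, 8, 9, 10, 11, 12, 13, 22, 23}"
  "writes (try_guess m) = {14, 15, 16, 17, 18, 19, 20, 21, 22, 23, 24}"
  "writes write_result = {0, 22}" "writes write_length = {1}"
  by (auto simp: prepare_def write_result_def write_length_def step_defs)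

lemma counters_safe_programs:
  "counters_safe prepare" "counters_safe (try_guess m)" "counters_safe write_result"
  "counters_safe write_length"
  by (simp_all add: prepare_def write_result_def write_length_def step_defs)

text \<open>The 4 is the overhead of the search loop, 2 once and 2 per guess.\<close>

definition solver_bound :: "bool \<Rightarrow> nat poly" where
  "solver_bound m = poly_cost prepare + [:4:] + poly_cost (try_guess m) + poly_cost write_result +
     poly_cost write_length"

text \<open>Only \<open>search\<close> has a loop bound other than the input length. It runs at most
  \<open>F\<close> rounds, and all other costs are padded by the factor \<open>F\<close>, which
  therefore has to be positive even when there are no guesses.\<close>

lemma solver_exec:
  fixes xs :: "nat list" and m :: bool
  defines "s1 \<equiv> sem prepare (input_store xs)"
  defines "s2 \<equiv> sem (search m) s1"
  assumes "s1 9 0 \<le> F" "0 < F"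
  shows "\<exists>t \<le> F * poly (solver_bound m) (length xs).
    exec (solver m) (input_store xs) t (sem write_length (sem write_result s2))"
proof -
  let ?n = "length xs"
  let ?s3 = "sem write_result s2"
  have n1: "s1 1 0 = ?n"
    unfolding s1_def by (subst sem_frame) (auto simp: writes_programs input_store_def)
  have n2: "s2 1 0 = ?n"
    unfolding s2_def using n1 by (subst sem_frame) (auto simp: search_def writes_programs)
  obtain t1 where t1: "t1 \<le> poly (poly_cost prepare) ?n" "exec (compile prepare) (input_store xs) t1 s1"
    using exec_compile[of prepare "input_store xs" "\<lambda>_. ?n"] poly_cost[of prepare 1 "\<lambda>_. ?n"]
    by (auto simp: bounds_programs writes_programs counters_safe_programs input_store_def s1_def)
  let ?B = "\<lambda>l. s1 l 0"
  obtain t2 where t2: "t2 \<le> cost ?B (search m)" "exec (compile (search m)) s1 t2 s2"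
    using exec_compile[of "search m" s1 ?B]
    by (auto simp: search_def bounds_programs writes_programs counters_safe_programs s2_def
        simp del: sem.simps compile.simps cost.simps)
  have "cost ?B (search m) = 2 + s1 9 0 * (poly (poly_cost (try_guess m)) ?n + 2)"
    using poly_cost[of "try_guess m" 1 ?B] n1 by (simp add: search_def bounds_programs)
  also have "\<dots> \<le> F * 2 + F * (poly (poly_cost (try_guess m)) ?n + 2)"
    using assms(3,4) by (intro add_mono mult_right_mono) auto
  finally have t2': "t2 \<le> F * (poly (poly_cost (try_guess m)) ?n + 4)"
    using t2(1) by (simp add: algebra_simps)
  obtain t3 where t3: "t3 \<le> poly (poly_cost write_result) ?n" "exec (compile write_result) s2 t3 ?s3"
    using exec_compile[of write_result s2 "\<lambda>_. ?n"] poly_cost[of write_result 1 "\<lambda>_. ?n"] n2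
    by (auto simp: bounds_programs writes_programs counters_safe_programs)
  obtain t4 where t4: "t4 \<le> poly (poly_cost write_length) ?n"
    "exec (compile write_length) ?s3 t4 (sem write_length ?s3)"
    using exec_compile[of write_length ?s3 "\<lambda>_. ?n"] poly_cost[of write_length 1 "\<lambda>_. ?n"]
    by (auto simp: bounds_programs writes_programs counters_safe_programs)
  have "exec (solver m) (input_store xs) (t1 + (t2 + (t3 + t4))) (sem write_length ?s3)"
    unfolding solver_def by (intro exec.Seq) (fact t1(2) t2(2) t3(2) t4(2))+
  moreover have "t1 + (t2 + (t3 + t4)) \<le> F * poly (solver_bound m) ?n"
  proof -
    have le: "x \<le> F * x" for x using assms(4) by simp
    have "t1 \<le> F * poly (poly_cost prepare) ?n" "t3 \<le> F * poly (poly_cost write_result) ?n"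
      "t4 \<le> F * poly (poly_cost write_length) ?n"
      using t1(1) t3(1) t4(1) le order.trans by blast+
    then show ?thesis using t2' by (simp add: solver_bound_def algebra_simps)
  qed
  ultimately show ?thesis by blast
qed

lemma write_sem:
  assumes "k < s 1 0" "s 2 0 = k"
  defines "s' \<equiv> sem write_length (sem write_result s)"
  shows "s 20 0 = 0 \<Longrightarrow> output_words s' = [0]"
    and "0 < s 20 0 \<Longrightarrow> output_words s' = 1 # map (\<lambda>a. s 21 (Suc a)) [0..<k]"
proof -
  let ?c = "FAssign 0 (Var 22) (Cell 21 (Var 22))"
  let ?t = "sem (For 22 1 ?c) s"
  have t0: "\<forall>i < s 1 0. ?t 0 i = s 21 i"
    by (rule For_invariant[where Inv = "\<lambda>j s'. \<forall>i<j. s' 0 i = s 21 i"]) (auto simp: less_Suc_eq)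
  have fr: "?t x = s x" if "x \<notin> {0, 22}" for x using that by (subst sem_frame) auto
  have s': "s' 1 0 = (if 0 < s 20 0 then k + 1 else 1)" "s' 0 0 = (if 0 < s 20 0 then 1 else 0)"
    "\<And>i. s' 0 (Suc i) = ?t 0 (Suc i)"
    using assms(2) fr by (simp_all add: s'_def write_length_def write_result_def)
  show "s 20 0 = 0 \<Longrightarrow> output_words s' = [0]" using s' by (simp add: output_words_def)
  assume "0 < s 20 0"
  then have "output_words s' = map (s' 0) [0..<Suc k]" using s' by (simp add: output_words_def)
  also have "\<dots> = s' 0 0 # map (\<lambda>a. s' 0 (Suc a)) [0..<k]"
    by (simp add: upt_conv_Cons map_Suc_upt[symmetric] del: upt_Suc)
  also have "\<dots> = 1 # map (\<lambda>a. s 21 (Suc a)) [0..<k]"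
    using \<open>0 < s 20 0\<close> s' t0 assms(1) by simp
  finally show "output_words s' = 1 # map (\<lambda>a. s 21 (Suc a)) [0..<k]" .
qed

lemma solver_correct:
  fixes I :: lq_instance and m :: bool
  assumes wf: "wf_instance I"
  defines "xs \<equiv> encode_instance I"
  defines "out \<equiv> output_words (sem write_length (sem write_result
    (sem (search m) (sem prepare (input_store xs)))))"
  shows "(\<nexists>M. solution m I M) \<Longrightarrow> out = no_solution"
    and "\<exists>M. solution m I M \<Longrightarrow> \<exists>M. max_size (solution m I) M \<and> out = encode_matching I M"
    and "sem prepare (input_store xs) 9 0 \<le> 2 ^ (num_lq I * max_lq_list I)"
    and "sem prepare (input_store xs) 9 0 \<le> 2 ^ (card (lq_agents I) * card (lq_agents I))"
proof -
  interpret W: wf_lq_instance I by unfold_locales (rule wf)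
  define s1 where "s1 = sem prepare (input_store xs)"
  define s2 where "s2 = sem (search m) s1"
  \<comment> \<open>The locale takes its weights from the final store \<open>s1\<close>, its other
    parameters from the earlier \<open>W.indexed\<close>; the stages in between leave the latter
    unchanged.\<close>
  interpret L: loaded_instance I "W.indexed 7" "W.indexed 0" "W.indexed 8" "W.indexed 6"
    "length xs" "s1 10"
    unfolding xs_def by (rule W.loaded_instance_indexed)
  define w where "w = sem weigh W.indexed"
  define q where "q = sem count_resources w"
  define k where "k = sem count_agents q"
  have s1: "s1 = (if k 12 0 < k 11 0 then k(9 := (k 9)(0 := 0)) else k)"
    by (simp add: s1_def prepare_def W.indexed_def w_def q_def k_def xs_def)
  have fw: "w x = W.indexed x" if "x \<notin> {9, 10, 22}" for x
    unfolding w_def using that by (subst sem_frame) (auto simp: step_defs)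
  have fq: "q x = w x" if "x \<notin> {11, 22}" for x
    unfolding q_def using that by (subst sem_frame) (auto simp: step_defs)
  have fk: "k x = q x" if "x \<notin> {12, 13, 22}" for x
    unfolding k_def using that by (subst sem_frame) (auto simp: step_defs)
  have fs: "s1 x = k x" if "x \<noteq> 9" for x using that by (simp add: s1)
  have f: "s1 x = W.indexed x" if "x \<notin> {9, 10, 11, 12, 13, 22}" for x
    using that fw fq fk fs by simp
  have zero: "W.indexed x i = 0" if "x \<in> {11, 12, 13, 20}" for x i
    using that by (subst W.indexed_frame) (auto simp: input_store_def)
  have len: "W.indexed 1 0 = length xs" using W.indexed_length by (simp add: xs_def)
  have ld: "L.loaded s1" using f len by (simp add: L.loaded_def)
  have wg: "w 9 0 = 2 ^ length (L.lq_from 0)"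
    "\<And>p. L.lq_pos p \<Longrightarrow> w 10 p = 2 ^ length (L.lq_from (Suc p))"
    using L.weigh_sem[of W.indexed] len by (simp_all add: w_def)
  have "q 11 0 = num_lq I"
    unfolding q_def by (rule L.count_resources_sem) (use fw len zero in simp_all)
  moreover have "k 12 0 = card (lq_agents I)"
    unfolding k_def by (rule L.count_agents_sem) (use fq fw len zero in simp_all)
  ultimately have 9: "s1 9 0 = (if card (lq_agents I) < num_lq I then 0 else 2 ^ length (L.lq_from 0))"
    using wg(1) fk fq by (simp add: s1)
  have "s1 9 0 = 2 ^ length (L.lq_from 0) \<or> (\<nexists>M. solution m I M)"
    using 9 L.solution_num_lq[of m] by fastforce
  moreover have "s1 10 p = 2 ^ length (L.lq_from (Suc p))" if "L.lq_pos p" for p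
    using wg(2)[OF that] fs fk fq by simp
  moreover have "s1 20 0 = 0" using f zero by simp
  ultimately have search: "(s2 20 0 = 0 \<and> (\<nexists>M. solution m I M)) \<or>
    (0 < s2 20 0 \<and> (\<exists>M. max_size (solution m I) M \<and> L.recorded M (s2 21)))"
    unfolding s2_def by (intro L.search_sem[OF ld])
  have f2: "s2 x = s1 x" if "x \<notin> {14..25}" for x
    unfolding s2_def using that by (subst sem_frame) (auto simp: search_def writes_programs)
  have na: "s2 2 0 = n_agents I" "n_agents I < s2 1 0"
    using f f2 W.indexed_agents len W.length_encode_ge by (simp_all add: xs_def)
  have out: "out = output_words (sem write_length (sem write_result s2))"
    by (simp add: out_def s2_def s1_def)
  note wr = write_sem[of _ s2, OF na(2,1), folded out]
  show "out = no_solution" if "\<nexists>M. solution m I M"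
    using that search wr(1) by (auto simp: no_solution_def max_size_def)
  show "\<exists>M. max_size (solution m I) M \<and> out = encode_matching I M" if "\<exists>M. solution m I M"
  proof -
    have "0 < s2 20 0" using that search by auto
    with search obtain M where M: "max_size (solution m I) M" "L.recorded M (s2 21)" by auto
    have "out = encode_matching I M"
      using wr(2)[OF \<open>0 < s2 20 0\<close>] M(2) na(2) f2 f len
      by (simp add: encode_matching_def L.recorded_def)
    then show ?thesis using M(1) by auto
  qed
  show "sem prepare (input_store xs) 9 0 \<le> 2 ^ (num_lq I * max_lq_list I)"
    using 9 L.length_lq_from_le_lists by (simp add: s1_def)
  show "sem prepare (input_store xs) 9 0 \<le> 2 ^ (card (lq_agents I) * card (lq_agents I))"
  proof (cases "card (lq_agents I) < num_lq I")
    case False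
    \<comment> \<open>Here \<open>num_lq I \<le> card (lq_agents I)\<close>, so the number of LQ
      edges is at most a square.\<close>
    then have "length (L.lq_from 0) \<le> card (lq_agents I) * card (lq_agents I)"
      using L.length_lq_from_le_agents by (meson leI mult_le_mono1 order.trans)
    then show ?thesis using 9 False by (simp add: s1_def)
  qed (use 9 in \<open>simp add: s1_def\<close>)
qed

text \<open>One function serves both parameter tuples, as a missing second word reads as 0:
  \<open>[k]\<close> gives the exponent \<open>k * k\<close>, and \<open>[q, l]\<close> the square
  of \<open>q + l\<close>, which dominates \<open>q * l\<close>.\<close>

definition param_bound :: "nat list \<Rightarrow> nat" where
  "param_bound xs = (let k = input_store xs 0 0 + input_store xs 0 1 in 2 ^ (k * k))"

definition power_loop :: for_com where
  "power_loop = For 4 2 (For 5 2 (FAssign 3 (Num 0) (Plus (Var 3) (Var 3))))"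

lemma power_loop_sem:
  assumes "s 3 0 = 1"
  shows "sem power_loop s 3 0 = 2 ^ (s 2 0 * s 2 0)"
proof -
  let ?a = "FAssign 3 (Num 0) (Plus (Var 3) (Var 3))"
  have inner: "sem (For 5 2 ?a) t 3 0 = t 3 0 * 2 ^ t 2 0" for t
    by (rule For_invariant[where Inv = "\<lambda>j s'. s' 3 0 = t 3 0 * 2 ^ j"]) simp_all
  show ?thesis
    unfolding power_loop_def
    by (rule For_invariant[where Inv = "\<lambda>j s'. s' 3 0 = 2 ^ (j * s 2 0)"])
      (use assms in \<open>simp_all add: inner power_add\<close>)
qed

lemma computable_param_bound: "computable param_bound"
proof -
  define c1 where "c1 = FSeq (FAssign 2 (Num 0) (Plus (Cell 0 (Num 0)) (Cell 0 (Num 1))))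
    (FAssign 3 (Num 0) (Num 1))"
  define c3 where "c3 = FSeq (FAssign 0 (Num 0) (Var 3)) (FAssign 1 (Num 0) (Num 1))"
  \<comment> \<open>Three separately compiled pieces, since \<open>c1\<close> writes array 2, which
    bounds the loops of \<open>power_loop\<close>.\<close>
  have "\<exists>t s. exec (Seq (compile c1) (Seq (compile power_loop) (compile c3))) (input_store xs) t s \<and>
    output_words s = [param_bound xs]" for xs
  proof -
    let ?s1 = "sem c1 (input_store xs)"
    let ?s2 = "sem power_loop ?s1"
    obtain t1 where t1: "exec (compile c1) (input_store xs) t1 ?s1"
      using exec_compile[of c1 "input_store xs" "\<lambda>_. 0"] by (auto simp: c1_def)
    obtain t2 where t2: "exec (compile power_loop) ?s1 t2 ?s2"
      using exec_compile[of power_loop ?s1 "\<lambda>l. ?s1 l 0"] by (auto simp: power_loop_def)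
    obtain t3 where t3: "exec (compile c3) ?s2 t3 (sem c3 ?s2)"
      using exec_compile[of c3 ?s2 "\<lambda>_. 0"] by (auto simp: c3_def)
    have "?s2 3 0 = param_bound xs"
      by (subst power_loop_sem) (simp_all add: c1_def param_bound_def Let_def)
    then have "output_words (sem c3 ?s2) = [param_bound xs]"
      by (simp add: c3_def output_words_def)
    then show ?thesis using exec.Seq[OF t1 exec.Seq[OF t2 t3]] by blast
  qed
  then show ?thesis unfolding computable_def by blast
qed

lemma fpt_solver:
  assumes X: "\<And>I. I \<in> X \<Longrightarrow> wf_instance I"
    and bound: "\<And>I. I \<in> X \<Longrightarrow>
      sem prepare (input_store (encode_instance I)) 9 0 \<le> param_bound (\<kappa> I)"
    and sol: "\<And>I. I \<in> X \<Longrightarrow> (\<nexists>M. solution m I M) \<Longrightarrow> P I no_solution"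
      "\<And>I M. I \<in> X \<Longrightarrow> max_size (solution m I) M \<Longrightarrow> P I (encode_matching I M)"
  shows "fpt encode_instance X P \<kappa>"
  unfolding fpt_def
proof (rule exI[of _ "solver m"], rule exI[of _ param_bound], rule exI[of _ "solver_bound m"],
    intro conjI ballI)
  show "computable param_bound" by (rule computable_param_bound)
  fix I assume I: "I \<in> X"
  let ?x = "input_store (encode_instance I)"
  let ?s = "sem write_length (sem write_result (sem (search m) (sem prepare ?x)))"
  have "0 < param_bound (\<kappa> I)" by (simp add: param_bound_def Let_def)
  from solver_exec[OF bound[OF I] this, of m]
  obtain t where t: "t \<le> param_bound (\<kappa> I) * poly (solver_bound m) (length (encode_instance I))"
    "exec (solver m) ?x t ?s" by blast
  have "P I (output_words ?s)"
    using solver_correct(1,2)[OF X[OF I], of m] sol[OF I] by (cases "\<exists>M. solution m I M") auto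
  with t show "\<exists>t s. exec (solver m) ?x t s \<and>
      t \<le> param_bound (\<kappa> I) * poly (solver_bound m) (length (encode_instance I)) \<and>
      P I (output_words s)" by blast
qed

lemma param_bounds:
  "2 ^ (q * l) \<le> param_bound [q, l]" "2 ^ (k * k) \<le> param_bound [k]"
proof -
  have "q * l \<le> (q + l) * (q + l)" by (intro mult_le_mono) auto
  then show "2 ^ (q * l) \<le> param_bound [q, l]" by (simp add: param_bound_def input_store_def Let_def)
  show "2 ^ (k * k) \<le> param_bound [k]" by (simp add: param_bound_def input_store_def)
qed

theorem theorem3:
  shows "fpt encode_instance maxefm_instances maxefm_solution (\<lambda>I. [num_lq I, max_lq_list I]) \<and>
         fpt encode_instance maxrsm_instances maxrsm_solution (\<lambda>I. [num_lq I, max_lq_list I]) \<and>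
         fpt encode_instance maxefm_instances maxefm_solution (\<lambda>I. [card (lq_agents I)]) \<and>
         fpt encode_instance maxrsm_instances maxrsm_solution (\<lambda>I. [card (lq_agents I)])"
proof (intro conjI)
  note b1 = order.trans[OF solver_correct(3) param_bounds(1)]
    and b2 = order.trans[OF solver_correct(4) param_bounds(2)]
  have efm: "fpt encode_instance maxefm_instances maxefm_solution \<kappa>"
    if "\<And>I. wf_instance I \<Longrightarrow> sem prepare (input_store (encode_instance I)) 9 0 \<le> param_bound (\<kappa> I)" for \<kappa>
    by (rule fpt_solver[where m = True])
      (use that in \<open>auto simp: maxefm_instances_def maxefm_solution_def solution_def\<close>)
  have rsm: "fpt encode_instance maxrsm_instances maxrsm_solution \<kappa>"
    if "\<And>I. wf_instance I \<Longrightarrow> sem prepare (input_store (encode_instance I)) 9 0 \<le> param_bound (\<kappa> I)" for \<kappa>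
    by (rule fpt_solver[where m = False])
      (use that in \<open>auto simp: maxrsm_instances_def maxrsm_solution_def solution_def max_size_def\<close>)
  show "fpt encode_instance maxefm_instances maxefm_solution (\<lambda>I. [num_lq I, max_lq_list I])"
    by (rule efm) (rule b1)
  show "fpt encode_instance maxrsm_instances maxrsm_solution (\<lambda>I. [num_lq I, max_lq_list I])"
    by (rule rsm) (rule b1)
  show "fpt encode_instance maxefm_instances maxefm_solution (\<lambda>I. [card (lq_agents I)])"
    by (rule efm) (rule b2)
  show "fpt encode_instance maxrsm_instances maxrsm_solution (\<lambda>I. [card (lq_agents I)])"
    by (rule rsm) (rule b2)
qed

end
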